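(* Let $X\subseteq\mathbb{P}(\mathbb{S}^n)$ be an irreducible closed subvariety. Then the Gaussian ML degree of $X$ equals the number of critical points of $\log f_{\det,S}$ away from $D_{\det,S}:=\mathrm{Supp}(\mathrm{div}(f_{\det,S}))$, where $f_{\det,S}(M)$ is the rational function on $X$ given by $\det(M)/\mathrm{tr}(SM)^n$ for a generic $S\in\mathbb{S}^n$.
   Context: $\mathbb{S}^n$ is the space of complex symmetric $n\times n$ matrices. Let $C_X\subseteq\mathbb{S}^n$ be the affine cone over $X$, and let $C_X^\circ$ be the open subset of the smooth locus of $C_X$ where $\det\neq 0$. For $S\in\mathbb{S}^n$ the Gaussian log likelihood function is $\ell_S(M)=\log(\det(M))-\mathrm{tr}(SM)$. The Gaussian ML degree of $X$ is the number of critical points of $\ell_S|_{C_X^\circ}$ for generic $S$, i.e. of points of $C_X^\circ$ at which the restriction to $C_X^\circ$ of the $1$-form $d\ell_S=\frac{d\det}{\det}-\mathrm{tr}(S\,dM)$ vanishes; for generic $S$ this number is finite, all critical points are reduced, and the number is independent of $S$. Critical points are by definition smooth points: the critical points of $\log f_{\det,S}$ away from $D_{\det,S}$ are the points of $X_{\mathrm{sm}}\setminus D_{\det,S}$ ($X_{\mathrm{sm}}$ the smooth locus of $X$) at which the $1$-form $d\log f_{\det,S}=df_{\det,S}/f_{\det,S}$ vanishes. Here $\mathrm{Supp}(\mathrm{div}(f_{\det,S}))$ is the support of the divisor on $X$ associated to the rational function $f_{\det,S}$. *)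

theory Defs
  imports "HOL-Analysis.Analysis" "HOL-Library.Extended_Nat"
begin

text \<open>The matrix type is a real vector space in the library; what is needed here is its
  structure as a complex vector space.\<close>

definition cscale :: "complex \<Rightarrow> complex^'n^'n \<Rightarrow> complex^'n^'n" where
  "cscale c M = (\<chi> i j. c * M $ i $ j)"

global_interpretation cmat: vector_space "cscale :: complex \<Rightarrow> complex^'n^'n \<Rightarrow> complex^'n^'n"
  by unfold_locales (simp_all add: cscale_def vec_eq_iff algebra_simps)

definition sym_mats :: "(complex^'n^'n) set" where
  "sym_mats = {M. transpose M = M}"

text \<open>Polynomials in the matrix entries, as functions (faithful since the field is infinite).
  A polynomial on the space of symmetric matrices is the restriction of one of these.\<close>

inductive_set poly_fun :: "(complex^'n^'n \<Rightarrow> complex) set" where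
  const: "(\<lambda>M. c) \<in> poly_fun"
| entry: "(\<lambda>M. M $ i $ j) \<in> poly_fun"
| add: "f \<in> poly_fun \<Longrightarrow> g \<in> poly_fun \<Longrightarrow> (\<lambda>M. f M + g M) \<in> poly_fun"
| mult: "f \<in> poly_fun \<Longrightarrow> g \<in> poly_fun \<Longrightarrow> (\<lambda>M. f M * g M) \<in> poly_fun"

definition hom_poly_fun :: "nat \<Rightarrow> (complex^'n^'n \<Rightarrow> complex) set" where
  "hom_poly_fun k = {f \<in> poly_fun. \<forall>c M. f (cscale c M) = c ^ k * f M}"

definition zariski_closed :: "(complex^'n^'n) set \<Rightarrow> bool" where
  "zariski_closed A \<longleftrightarrow> (\<exists>F \<subseteq> poly_fun. A = {M \<in> sym_mats. \<forall>f\<in>F. f M = 0})"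

text \<open>A property holds for generic \<open>S\<close> if it holds on a nonempty (hence dense) Zariski open
  subset of the space of symmetric matrices.\<close>

definition for_generic :: "(complex^'n^'n \<Rightarrow> bool) \<Rightarrow> bool" where
  "for_generic P \<longleftrightarrow>
     (\<exists>A. zariski_closed A \<and> sym_mats - A \<noteq> {} \<and> (\<forall>S \<in> sym_mats - A. P S))"


subsection \<open>Affine varieties in the space of symmetric matrices\<close>

definition dir_deriv ::
    "(complex^'n^'n \<Rightarrow> complex) \<Rightarrow> complex^'n^'n \<Rightarrow> complex^'n^'n \<Rightarrow> complex" where
  "dir_deriv f M v = deriv (\<lambda>t. f (M + cscale t v)) 0"

definition vanishing_ideal :: "(complex^'n^'n) set \<Rightarrow> (complex^'n^'n \<Rightarrow> complex) set" where
  "vanishing_ideal V = {f \<in> poly_fun. \<forall>M\<in>V. f M = 0}"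

text \<open>Zariski tangent space. It consists of symmetric matrices if \<open>V\<close> does, because the linear
  forms \<open>M $ i $ j - M $ j $ i\<close> then lie in the vanishing ideal.\<close>

definition tangent_space :: "(complex^'n^'n) set \<Rightarrow> complex^'n^'n \<Rightarrow> (complex^'n^'n) set" where
  "tangent_space V M = {v. \<forall>f \<in> vanishing_ideal V. dir_deriv f M v = 0}"

text \<open>Algebraic independence over the complex numbers of \<open>f 0, \<dots>, f (k - 1)\<close> in the coordinate
  ring of \<open>V\<close>: distinct monomials in them are linearly independent as functions on \<open>V\<close>.\<close>

definition alg_indep_on ::
    "(complex^'n^'n) set \<Rightarrow> nat \<Rightarrow> (nat \<Rightarrow> complex^'n^'n \<Rightarrow> complex) \<Rightarrow> bool" where
  "alg_indep_on V k f \<longleftrightarrow>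
     (\<forall>E c. finite E \<and> E \<subseteq> {e :: nat \<Rightarrow> nat. \<forall>i\<ge>k. e i = 0} \<and>
        (\<forall>M\<in>V. (\<Sum>e\<in>E. c e * (\<Prod>i<k. f i M ^ e i)) = 0) \<longrightarrow> (\<forall>e\<in>E. c e = 0))"

text \<open>The dimension of an irreducible affine variety is the transcendence degree of its function
  field, which is that of its coordinate ring.\<close>

definition variety_dim :: "(complex^'n^'n) set \<Rightarrow> enat" where
  "variety_dim V = (SUP k \<in> {k. \<exists>f. (\<forall>i<k. f i \<in> poly_fun) \<and> alg_indep_on V k f}. enat k)"

definition smooth_at :: "(complex^'n^'n) set \<Rightarrow> complex^'n^'n \<Rightarrow> bool" where
  "smooth_at V M \<longleftrightarrow> M \<in> V \<and> enat (cmat.dim (tangent_space V M)) = variety_dim V"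


subsection \<open>Projective varieties\<close>

text \<open>A point of the projective space is a line through the origin, as a set of matrices.\<close>

definition proj_space :: "(complex^'n^'n) set set" where
  "proj_space = {cmat.span {M} | M. M \<in> sym_mats \<and> M \<noteq> 0}"

definition proj_closed :: "(complex^'n^'n) set set \<Rightarrow> bool" where
  "proj_closed X \<longleftrightarrow>
     (\<exists>F \<subseteq> (\<Union>k. hom_poly_fun k). X = {p \<in> proj_space. \<forall>f\<in>F. \<forall>M\<in>p - {0}. f M = 0})"

definition proj_irreducible :: "(complex^'n^'n) set set \<Rightarrow> bool" where
  "proj_irreducible X \<longleftrightarrow> X \<noteq> {} \<and>
     (\<forall>A B. proj_closed A \<and> proj_closed B \<and> X \<subseteq> A \<union> B \<longrightarrow> X \<subseteq> A \<or> X \<subseteq> B)"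

definition affine_cone :: "(complex^'n^'n) set set \<Rightarrow> (complex^'n^'n) set" where
  "affine_cone X = {0} \<union> \<Union>X"

text \<open>The standard affine chart of \<open>X\<close> on which the \<open>(i, j)\<close> entry is nonzero; a point \<open>p\<close> of \<open>X\<close>
  in this chart corresponds to the unique \<open>M \<in> p\<close> with \<open>M $ i $ j = 1\<close>.\<close>

definition chart :: "(complex^'n^'n) set set \<Rightarrow> 'n \<Rightarrow> 'n \<Rightarrow> (complex^'n^'n) set" where
  "chart X i j = {M \<in> affine_cone X. M $ i $ j = 1}"

text \<open>Smoothness does not depend on the chart.\<close>

definition proj_smooth_at :: "(complex^'n^'n) set set \<Rightarrow> (complex^'n^'n) set \<Rightarrow> bool" where
  "proj_smooth_at X p \<longleftrightarrow>
     p \<in> X \<and> (\<exists>i j. \<exists>M\<in>p. M $ i $ j = 1 \<and> smooth_at (chart X i j) M)"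


subsection \<open>Rational functions on a projective variety\<close>

text \<open>For homogeneous \<open>g\<close>, \<open>h\<close> of equal degree, \<open>h\<close> not identically zero on \<open>X\<close>, the rational function
  \<open>g / h\<close> is a unit of the local ring of \<open>X\<close> at \<open>p\<close> iff it equals \<open>a / b\<close> in the function field for
  homogeneous \<open>a\<close>, \<open>b\<close> of equal degree that do not vanish at \<open>p\<close>.\<close>

definition unit_rep ::
    "(complex^'n^'n) set set \<Rightarrow> (complex^'n^'n \<Rightarrow> complex) \<Rightarrow> (complex^'n^'n \<Rightarrow> complex) \<Rightarrow>
     (complex^'n^'n) set \<Rightarrow> (complex^'n^'n \<Rightarrow> complex) \<Rightarrow> (complex^'n^'n \<Rightarrow> complex) \<Rightarrow> bool" where
  "unit_rep X g h p a b \<longleftrightarrow>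
     (\<exists>k. a \<in> hom_poly_fun k \<and> b \<in> hom_poly_fun k) \<and>
     (\<forall>M\<in>p - {0}. a M \<noteq> 0 \<and> b M \<noteq> 0) \<and>
     (\<forall>M\<in>affine_cone X. g M * b M = h M * a M)"

text \<open>The support of the principal (Cartier) divisor of \<open>g / h\<close>: the points at which \<open>g / h\<close> is not a
  unit of the local ring. At smooth points, where the local ring is factorial, this is the union
  of the prime divisors along which \<open>g / h\<close> has a zero or a pole. It is all of \<open>X\<close> if \<open>g / h = 0\<close>.\<close>

definition supp_div ::
    "(complex^'n^'n) set set \<Rightarrow> (complex^'n^'n \<Rightarrow> complex) \<Rightarrow> (complex^'n^'n \<Rightarrow> complex) \<Rightarrow>
     (complex^'n^'n) set set" where
  "supp_div X g h = {p \<in> X. \<nexists>a b. unit_rep X g h p a b}"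

text \<open>The 1-form \<open>d log (g / h)\<close> at \<open>p\<close>, computed in a chart from a local representative \<open>a / b\<close>; the
  result depends on neither.\<close>

definition dlog_vanishes_at ::
    "(complex^'n^'n) set set \<Rightarrow> (complex^'n^'n \<Rightarrow> complex) \<Rightarrow> (complex^'n^'n \<Rightarrow> complex) \<Rightarrow>
     (complex^'n^'n) set \<Rightarrow> bool" where
  "dlog_vanishes_at X g h p \<longleftrightarrow>
     (\<forall>a b i j. unit_rep X g h p a b \<longrightarrow>
        (\<forall>M\<in>p. M $ i $ j = 1 \<longrightarrow>
           (\<forall>v \<in> tangent_space (chart X i j) M.
              dir_deriv (\<lambda>N. a N / b N) M v / (a M / b M) = 0)))"

definition log_critical_points ::
    "(complex^'n^'n) set set \<Rightarrow> (complex^'n^'n \<Rightarrow> complex) \<Rightarrow> (complex^'n^'n \<Rightarrow> complex) \<Rightarrow>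
     (complex^'n^'n) set set" where
  "log_critical_points X g h =
     {p \<in> X. proj_smooth_at X p \<and> p \<notin> supp_div X g h \<and> dlog_vanishes_at X g h p}"


subsection \<open>The Gaussian maximum likelihood degree\<close>

definition cone_open_part :: "(complex^'n^'n) set set \<Rightarrow> (complex^'n^'n) set" where
  "cone_open_part X = {M. smooth_at (affine_cone X) M \<and> det M \<noteq> 0}"

definition likelihood_critical_points ::
    "(complex^'n^'n) set set \<Rightarrow> complex^'n^'n \<Rightarrow> (complex^'n^'n) set" where
  "likelihood_critical_points X S =
     {M \<in> cone_open_part X. \<forall>v \<in> tangent_space (affine_cone X) M.
        dir_deriv det M v / det M - trace (S ** v) = 0}"

text \<open>Stated as a relation: \<open>d\<close> is the (unique) number of critical points for generic \<open>S\<close>.\<close>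

definition is_gaussian_ML_degree :: "(complex^'n^'n) set set \<Rightarrow> nat \<Rightarrow> bool" where
  "is_gaussian_ML_degree X d \<longleftrightarrow>
     for_generic (\<lambda>S. finite (likelihood_critical_points X S) \<and>
                      card (likelihood_critical_points X S) = d)"

text \<open>Critical points of \<open>log f\<close> away from the support of \<open>div f\<close>, for \<open>f M = det M / tr (S M) ^ n\<close>.\<close>

definition det_trace_critical_points ::
    "(complex^'n^'n) set set \<Rightarrow> complex^'n^'n \<Rightarrow> (complex^'n^'n) set set" where
  "det_trace_critical_points X S =
     log_critical_points X det (\<lambda>M. trace (S ** M) ^ CARD('n))"

end

theory Submission
  imports Defs "HOL-Library.Function_Algebras"
begin

text \<open>Write \<open>C\<close> for the cone over \<open>X\<close>. The two sets of critical points correspond under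
  \<open>M \<mapsto> span {M}\<close>.

  Since \<open>C\<close> is a cone, \<open>M\<close> itself is tangent to \<open>C\<close> at \<open>M\<close>. Putting \<open>v = M\<close> into the likelihood
  equation \<open>d det(v) / det M = tr (S v)\<close> gives \<open>tr (S M) = n\<close> by Euler's formula. Consider now the
  form \<open>\<omega>(v) = d det(v) / det M - n tr (S v) / tr (S M)\<close>. It agrees with the likelihood equation when
  \<open>tr (S M) = n\<close>, it kills \<open>v = M\<close>, and replacing \<open>M\<close> by \<open>c M\<close> divides it by \<open>c\<close>; so its vanishing on
  the tangent space of \<open>C\<close> depends only on the line through \<open>M\<close> and can be tested on the tangent space
  of a chart, where \<open>\<omega>\<close> is \<open>d log (det / tr (S M) ^ n)\<close>. Therefore a line with \<open>det \<noteq> 0\<close> and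
  \<open>tr (S M) \<noteq> 0\<close> is critical iff its unique representative with \<open>tr (S M) = n\<close> is
  (\<open>log_critical_iff\<close>, \<open>likelihood_critical_iff\<close>).

  Two points need more work.

  First, \<open>det\<close> may vanish at a point where \<open>det / tr (S M) ^ n\<close> is still a unit, because a zero of the
  determinant and a zero of the denominator cancel. For generic \<open>S\<close> this does not happen
  (\<open>det_nonzero_at_units\<close>): the zero set of \<open>det\<close> on \<open>C\<close> does not depend on \<open>S\<close> and is a finite union of
  irreducible sets. If \<open>S\<close> is such that \<open>tr (S M)\<close> vanishes identically on none of them that contains a
  nonzero matrix, then \<open>det b = tr (S M) ^ n a\<close> forces \<open>a = 0\<close> on each of these, which contradicts
  \<open>a \<noteq> 0\<close> at the point. Finiteness of the decomposition comes from the Hilbert basis theorem, proved here for rings of functions.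

  Second, smoothness of a point of \<open>X\<close> is measured in a chart, and has to be compared with smoothness
  of \<open>C\<close> (\<open>proj_smooth_at_iff\<close>). The tangent space of the chart \<open>x = 1\<close> is the hyperplane \<open>dx = 0\<close> in that
  of \<open>C\<close>, so its dimension is smaller by one. The transcendence degree is also smaller by exactly one
  (\<open>variety_dim_cone\<close>). If \<open>k\<close> functions are independent on the chart, then their homogenizations
  together with \<open>x\<close> are independent on \<open>C\<close>. If \<open>k\<close> is moreover maximal, then all coordinates are
  algebraic over these \<open>k + 1\<close> functions, and one has to know that any \<open>k + 2\<close> polynomials on \<open>C\<close> are then
  dependent. This is proved by counting: up to a power of a common denominator, the
  \<open>(m + 1) ^ (k + 2)\<close> monomials with exponents at most \<open>m\<close> lie in a space of dimension
  \<open>O(m ^ (k + 1))\<close>.\<close>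

section \<open>Noetherian rings of functions\<close>

definition is_subring :: "'r::comm_ring_1 set \<Rightarrow> bool" where
  "is_subring A \<longleftrightarrow> 1 \<in> A \<and> (\<forall>a\<in>A. \<forall>b\<in>A. a - b \<in> A \<and> a * b \<in> A)"

text \<open>Noetherian in terms of sequences: some member is a combination of the earlier ones. This is the
  ascending chain condition for finitely generated ideals, and it avoids talking about ideals.\<close>
definition is_noetherian :: "'r::comm_ring_1 set \<Rightarrow> bool" where
  "is_noetherian A \<longleftrightarrow>
     (\<forall>f :: nat \<Rightarrow> 'r. range f \<subseteq> A \<longrightarrow> (\<exists>m u. range u \<subseteq> A \<and> f m = (\<Sum>i<m. u i * f i)))"

text \<open>Polynomial expressions in \<open>x\<close> of degree less than \<open>d\<close> with coefficients in \<open>A\<close>. As \<open>x\<close> may be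
  algebraic over \<open>A\<close>, an element can have several such expressions; only the existence of one of small
  degree is ever used, so the argument for polynomial rings applies verbatim. A strict bound is used
  because then \<open>d = 0\<close> gives the zero element.\<close>
definition polys_below :: "'r::comm_ring_1 set \<Rightarrow> 'r \<Rightarrow> nat \<Rightarrow> 'r set" where
  "polys_below A x d = {\<Sum>i<d. a i * x ^ i | a. range a \<subseteq> A}"

definition adjoin :: "'r::comm_ring_1 set \<Rightarrow> 'r \<Rightarrow> 'r set" where
  "adjoin A x = (\<Union>d. polys_below A x d)"

lemma
  assumes "is_subring A"
  shows subring_1: "1 \<in> A" and subring_0: "0 \<in> A"
    and subring_diff: "a \<in> A \<Longrightarrow> b \<in> A \<Longrightarrow> a - b \<in> A"
    and subring_mult: "a \<in> A \<Longrightarrow> b \<in> A \<Longrightarrow> a * b \<in> A"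
    and subring_uminus: "a \<in> A \<Longrightarrow> - a \<in> A"
    and subring_add: "a \<in> A \<Longrightarrow> b \<in> A \<Longrightarrow> a + b \<in> A"
proof -
  show 1: "1 \<in> A" and d: "a \<in> A \<Longrightarrow> b \<in> A \<Longrightarrow> a - b \<in> A" for a b
    using assms by (auto simp: is_subring_def)
  show "a \<in> A \<Longrightarrow> b \<in> A \<Longrightarrow> a * b \<in> A"
    using assms by (auto simp: is_subring_def)
  show 0: "0 \<in> A" using d[OF 1 1] by simp
  show u: "a \<in> A \<Longrightarrow> - a \<in> A" for a using d[OF 0] by fastforce
  show "a \<in> A \<Longrightarrow> b \<in> A \<Longrightarrow> a + b \<in> A" using d[OF _ u] by fastforce
qed

lemma polys_below_0 [simp]: "0 \<in> A \<Longrightarrow> polys_below A x 0 = {0}"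
  by (auto simp: polys_below_def intro!: exI[of _ "\<lambda>_. 0"])

lemma polys_below_mono:
  assumes "is_subring A" "d \<le> e"
  shows "polys_below A x d \<subseteq> polys_below A x e"
proof
  fix p assume "p \<in> polys_below A x d"
  then obtain a where a: "range a \<subseteq> A" "p = (\<Sum>i<d. a i * x ^ i)"
    by (auto simp: polys_below_def)
  have "p = (\<Sum>i<e. (if i < d then a i else 0) * x ^ i)"
    unfolding a(2) using assms(2) by (intro sum.mono_neutral_cong_left) auto
  then show "p \<in> polys_below A x e"
    using a(1) subring_0[OF assms(1)] unfolding polys_below_def
    by (intro CollectI exI[of _ "\<lambda>i. if i < d then a i else 0"]) auto
qed

lemma polys_below_diff:
  assumes "is_subring A" "p \<in> polys_below A x d" "q \<in> polys_below A x d"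
  shows "p - q \<in> polys_below A x d"
proof -
  from assms obtain a b where "range a \<subseteq> A" "p = (\<Sum>i<d. a i * x ^ i)"
     "range b \<subseteq> A" "q = (\<Sum>i<d. b i * x ^ i)"
    by (auto simp: polys_below_def)
  then show ?thesis using subring_diff[OF assms(1)] unfolding polys_below_def
    by (intro CollectI exI[of _ "\<lambda>i. a i - b i"]) (auto simp: sum_subtractf algebra_simps)
qed

lemma polys_below_zero: "is_subring A \<Longrightarrow> 0 \<in> polys_below A x d"
  using polys_below_mono[of A 0 d x] subring_0[of A] by auto

lemma polys_below_add:
  assumes "is_subring A" "p \<in> polys_below A x d" "q \<in> polys_below A x d"
  shows "p + q \<in> polys_below A x d"
  using polys_below_diff[OF assms(1) assms(2)
      polys_below_diff[OF assms(1) polys_below_zero[OF assms(1)] assms(3)]]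
  by simp

lemma polys_below_monomial_mult:
  assumes "is_subring A" "c \<in> A" "p \<in> polys_below A x d"
  shows "c * x ^ k * p \<in> polys_below A x (d + k)"
proof -
  obtain a where a: "range a \<subseteq> A" "p = (\<Sum>i<d. a i * x ^ i)"
    using assms by (auto simp: polys_below_def)
  have "(\<Sum>i<d+k. (if k \<le> i then c * a (i - k) else 0) * x ^ i)
      = (\<Sum>i\<in>{k..<d+k}. c * a (i - k) * x ^ i)"
    by (intro sum.mono_neutral_cong_right) auto
  also have "\<dots> = (\<Sum>i<d. c * a i * x ^ (i + k))"
    by (rule sum.reindex_bij_witness[of _ "\<lambda>i. i + k" "\<lambda>i. i - k"]) auto
  also have "\<dots> = c * x ^ k * p"
    unfolding a(2) by (simp add: sum_distrib_left power_add algebra_simps)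
  finally show ?thesis
    using a(1) subring_0[OF assms(1)] subring_mult[OF assms(1,2)] unfolding polys_below_def
    by (intro CollectI exI[of _ "\<lambda>i. if k \<le> i then c * a (i - k) else 0"]) auto
qed

lemma polys_below_in_adjoin: "p \<in> polys_below A x d \<Longrightarrow> p \<in> adjoin A x"
  by (auto simp: adjoin_def)

lemma adjoin_obtain_common_degree:
  assumes "is_subring A" "p \<in> adjoin A x" "q \<in> adjoin A x"
  obtains d where "p \<in> polys_below A x d" "q \<in> polys_below A x d"
proof -
  from assms obtain d e where "p \<in> polys_below A x d" "q \<in> polys_below A x e"
    by (auto simp: adjoin_def)
  then show ?thesis
    using polys_below_mono[OF assms(1), of d "max d e" x] polys_below_mono[OF assms(1), of e "max d e" x]
    by (intro that[of "max d e"]) auto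
qed

lemma subset_adjoin:
  assumes "is_subring A" shows "A \<subseteq> adjoin A x"
proof
  fix c assume c: "c \<in> A"
  have "c * x ^ 0 * 1 \<in> polys_below A x (1 + 0)"
    by (rule polys_below_monomial_mult[OF assms c])
       (auto simp: polys_below_def intro!: exI[of _ "\<lambda>_. 1"] subring_1[OF assms])
  then show "c \<in> adjoin A x" by (auto intro: polys_below_in_adjoin)
qed

lemma mem_adjoin:
  assumes "is_subring A" shows "x \<in> adjoin A x"
proof -
  have "1 * x ^ 1 * 1 \<in> polys_below A x (1 + 1)"
    by (rule polys_below_monomial_mult[OF assms subring_1[OF assms]])
       (auto simp: polys_below_def intro!: exI[of _ "\<lambda>_. 1"] subring_1[OF assms])
  then show ?thesis by (auto intro: polys_below_in_adjoin)
qed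

lemma is_subring_adjoin:
  assumes "is_subring A" shows "is_subring (adjoin A x)"
proof -
  have "p * q \<in> adjoin A x" if "p \<in> polys_below A x d" "q \<in> polys_below A x e" for p q d e
    using that(1)
  proof (induction d arbitrary: p)
    case 0
    have "0 \<in> adjoin A x" by (rule polys_below_in_adjoin[OF polys_below_zero[OF assms, of x 0]])
    then show ?case using 0 subring_0[OF assms] by simp
  next
    case (Suc d)
    then obtain a where a: "range a \<subseteq> A" "p = (\<Sum>i<Suc d. a i * x ^ i)"
      by (auto simp: polys_below_def)
    have "(\<Sum>i<d. a i * x ^ i) * q \<in> adjoin A x"
      by (rule Suc.IH) (use a in \<open>auto simp: polys_below_def\<close>)
    moreover have "a d * x ^ d * q \<in> adjoin A x"
      using polys_below_monomial_mult[OF assms, of "a d" q x e d] a(1) that(2)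
      by (auto intro: polys_below_in_adjoin)
    ultimately obtain k where "(\<Sum>i<d. a i * x ^ i) * q \<in> polys_below A x k"
       "a d * x ^ d * q \<in> polys_below A x k"
      using adjoin_obtain_common_degree[OF assms] by metis
    from polys_below_add[OF assms this] show ?case
      unfolding a(2) by (simp add: distrib_right polys_below_in_adjoin)
  qed
  moreover have "p - q \<in> adjoin A x" if "p \<in> adjoin A x" "q \<in> adjoin A x" for p q
    using adjoin_obtain_common_degree[OF assms that] polys_below_diff[OF assms]
    by (metis polys_below_in_adjoin)
  moreover have "1 \<in> adjoin A x" using subset_adjoin[OF assms] subring_1[OF assms] by blast
  ultimately show ?thesis
    unfolding is_subring_def by (auto simp: adjoin_def)
qed

text \<open>Hilbert's argument by leading coefficients. Given a sequence \<open>f\<close> none of whose members is a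
  combination of its predecessors, let \<open>I\<close> be the ideal generated by all of \<open>f\<close> and choose for every
  \<open>N\<close> an element \<open>g N\<close> of least degree in \<open>I\<close> outside the ideal \<open>J N\<close> of the first \<open>N\<close> members. Along a
  subsequence \<open>n\<close> growing fast enough, \<open>g (n i)\<close> lies in \<open>J (n m)\<close> for all \<open>i < m\<close>. A relation between the
  leading coefficients of the \<open>g (n i)\<close> then cancels the leading term of some \<open>g (n m)\<close> modulo
  \<open>J (n m)\<close>, against minimality.\<close>
theorem hilbert_basis:
  assumes sub: "is_subring A" and noeth: "is_noetherian A"
  shows "is_noetherian (adjoin A x)"
proof (unfold is_noetherian_def, intro allI impI, rule ccontr)
  let ?B = "adjoin A x"
  fix f :: "nat \<Rightarrow> 'a"
  assume f: "range f \<subseteq> ?B"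
    and contra: "\<nexists>m u. range u \<subseteq> ?B \<and> f m = (\<Sum>i<m. u i * f i)"
  note subB = is_subring_adjoin[OF sub, of x]
  define J where "J m = {\<Sum>i<m. u i * f i | u. range u \<subseteq> ?B}" for m
  define I where "I = (\<Union>m. J m)"
  have J_mono: "J m \<subseteq> J k" if "m \<le> k" for m k
  proof
    fix p assume "p \<in> J m"
    then obtain u where u: "range u \<subseteq> ?B" "p = (\<Sum>i<m. u i * f i)" by (auto simp: J_def)
    have "p = (\<Sum>i<k. (if i < m then u i else 0) * f i)"
      unfolding u(2) using that by (intro sum.mono_neutral_cong_left) auto
    then show "p \<in> J k"
      using u(1) subring_0[OF subB] unfolding J_def
      by (intro CollectI exI[of _ "\<lambda>i. if i < m then u i else 0"]) auto
  qed
  have J_diff: "p - q \<in> J m" if pq: "p \<in> J m" "q \<in> J m" for p q m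
  proof -
    from pq obtain u v where "range u \<subseteq> ?B" "p = (\<Sum>i<m. u i * f i)"
      "range v \<subseteq> ?B" "q = (\<Sum>i<m. v i * f i)" by (auto simp: J_def)
    then show ?thesis using subring_diff[OF subB] unfolding J_def
      by (intro CollectI exI[of _ "\<lambda>i. u i - v i"]) (auto simp: sum_subtractf algebra_simps)
  qed
  have J_mult: "b * p \<in> J m" if p: "b \<in> ?B" "p \<in> J m" for b p m
  proof -
    from p obtain u where "range u \<subseteq> ?B" "p = (\<Sum>i<m. u i * f i)" by (auto simp: J_def)
    then show ?thesis using subring_mult[OF subB p(1)] unfolding J_def
      by (intro CollectI exI[of _ "\<lambda>i. b * u i"]) (auto simp: sum_distrib_left mult.assoc)
  qed
  have J_0: "0 \<in> J m" for m
    using subring_0[OF subB] unfolding J_def by (intro CollectI exI[of _ "\<lambda>i. 0"]) auto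
  have J_sum: "(\<Sum>i\<in>T. h i) \<in> J m" if "\<And>i. i \<in> T \<Longrightarrow> h i \<in> J m" for T :: "nat set" and h m
    using that
  proof (induction T rule: infinite_finite_induct)
    case (insert i T)
    have "h i + sum h T = h i - (0 - sum h T)" by simp
    also have "\<dots> \<in> J m" using insert by (intro J_diff J_0) auto
    finally show ?case using insert by simp
  qed (auto simp: J_0)
  have f_in: "f m \<in> J (Suc m)" for m
  proof -
    have "f m = (\<Sum>i<Suc m. (if i = m then 1 else 0) * f i)" by simp
    then show ?thesis using subring_0[OF subB] subring_1[OF subB] unfolding J_def
      by (intro CollectI exI[of _ "\<lambda>i. if i = m then 1 else 0"]) auto
  qed
  have f_notin: "f m \<notin> J m" for m using contra by (auto simp: J_def)
  have ex: "\<exists>d. \<exists>g. g \<in> I - J N \<and> g \<in> polys_below A x d" for N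
    using f_in[of N] f_notin[of N] f by (auto simp: I_def adjoin_def) blast
  define D where "D N = (LEAST d. \<exists>g. g \<in> I - J N \<and> g \<in> polys_below A x d)" for N
  have "\<exists>g. g \<in> I - J N \<and> g \<in> polys_below A x (D N)" for N
    unfolding D_def by (rule LeastI_ex[OF ex])
  then obtain g where g: "\<And>N. g N \<in> I" "\<And>N. g N \<notin> J N" "\<And>N. g N \<in> polys_below A x (D N)"
    by (metis DiffD1 DiffD2)
  have D_min: "D N \<le> d" if "h \<in> I" "h \<notin> J N" "h \<in> polys_below A x d" for N d h
    unfolding D_def using that by (intro Least_le) auto
  have D_mono: "D N \<le> D N'" if "N \<le> N'" for N N'
    using D_min[of "g N'" N "D N'"] g[of N'] J_mono[OF that] by auto
  have D_pos: "D N > 0" for N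
    using g[of N] J_0[of N] subring_0[OF sub] by (intro gr0I) auto
  have "\<exists>c r. c \<in> A \<and> r \<in> polys_below A x (D N - 1) \<and> g N = c * x ^ (D N - 1) + r" for N
  proof -
    obtain a where a: "range a \<subseteq> A" "g N = (\<Sum>i<D N. a i * x ^ i)"
      using g(3)[of N] by (auto simp: polys_below_def)
    have "g N = a (D N - 1) * x ^ (D N - 1) + (\<Sum>i<D N - 1. a i * x ^ i)"
      using a(2) sum.lessThan_Suc[of "\<lambda>i. a i * x ^ i" "D N - 1"] D_pos[of N] by simp
    then show ?thesis using a(1) by (auto simp: polys_below_def)
  qed
  then obtain c r where cr: "\<And>N. c N \<in> A" "\<And>N. r N \<in> polys_below A x (D N - 1)"
     "\<And>N. g N = c N * x ^ (D N - 1) + r N" by metis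
  have "\<exists>N' \<ge> N. g N \<in> J N'" for N
  proof -
    obtain k where "g N \<in> J k" using g(1)[of N] by (auto simp: I_def)
    then show ?thesis using J_mono[of k "max k N"] by (intro exI[of _ "max k N"]) auto
  qed
  then obtain s where s: "\<And>N. s N \<ge> N" "\<And>N. g N \<in> J (s N)" by metis
  \<comment> \<open>The ideal with index \<open>s N\<close> contains \<open>g N\<close>, so iterating \<open>s\<close> makes each chosen element available to
    all later ones.\<close>
  define n where "n k = (s ^^ k) 0" for k
  have n_mono: "n i \<le> n k" if "i \<le> k" for i k
    by (rule lift_Suc_mono_le[OF _ that]) (simp add: n_def s)
  have g_prev: "g (n i) \<in> J (n m)" if "i < m" for i m
    using s(2)[of "n i"] J_mono[OF n_mono[of "Suc i" m]] that by (auto simp: n_def)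
  obtain m u where u: "range u \<subseteq> A" "c (n m) = (\<Sum>i<m. u i * c (n i))"
    using noeth[unfolded is_noetherian_def, rule_format, of "\<lambda>k. c (n k)"] cr(1) by auto
  define e where "e i = D (n m) - D (n i)" for i
  have e: "D (n m) - 1 = (D (n i) - 1) + e i" if "i < m" for i
    using D_mono[OF n_mono[of i m]] D_pos[of "n i"] that by (simp add: e_def)
  \<comment> \<open>The leading terms cancel by the relation between the leading coefficients.\<close>
  define h where "h = g (n m) - (\<Sum>i<m. u i * x ^ e i * g (n i))"
  have "h = c (n m) * x ^ (D (n m) - 1) + r (n m)
          - (\<Sum>i<m. u i * x ^ e i * (c (n i) * x ^ (D (n i) - 1) + r (n i)))"
    unfolding h_def by (simp add: cr(3))
  also have "(\<Sum>i<m. u i * x ^ e i * (c (n i) * x ^ (D (n i) - 1) + r (n i)))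
     = (\<Sum>i<m. u i * c (n i) * x ^ (D (n m) - 1)) + (\<Sum>i<m. u i * x ^ e i * r (n i))"
    unfolding sum.distrib[symmetric]
    by (intro sum.cong refl) (simp add: e power_add algebra_simps del: One_nat_def)
  also have "(\<Sum>i<m. u i * c (n i) * x ^ (D (n m) - 1)) = c (n m) * x ^ (D (n m) - 1)"
    unfolding u(2) by (simp add: sum_distrib_right)
  finally have h_eq: "h = r (n m) - (\<Sum>i<m. u i * x ^ e i * r (n i))" by simp
  have "u i * x ^ e i * r (n i) \<in> polys_below A x (D (n m) - 1)" if "i < m" for i
    unfolding e[OF that] using u(1) cr(2) by (intro polys_below_monomial_mult[OF sub]) auto
  note terms = this
  have "(\<Sum>i\<in>T. u i * x ^ e i * r (n i)) \<in> polys_below A x (D (n m) - 1)"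
    if "finite T" "T \<subseteq> {..<m}" for T
    using that
    by (induction T rule: finite_induct)
       (auto intro: polys_below_zero[OF sub] polys_below_add[OF sub] terms simp del: One_nat_def)
  then have h_low: "h \<in> polys_below A x (D (n m) - 1)"
    unfolding h_eq using cr(2) by (intro polys_below_diff[OF sub]) auto
  have low_J: "(\<Sum>i<m. u i * x ^ e i * g (n i)) \<in> J (n m)"
  proof (rule J_sum, rule J_mult)
    fix i assume "i \<in> {..<m}"
    have "u i * x ^ e i * 1 \<in> polys_below A x (1 + e i)"
      using u(1) by (intro polys_below_monomial_mult[OF sub])
        (auto simp: polys_below_def intro!: exI[of _ "\<lambda>_. 1"] subring_1[OF sub])
    then show "u i * x ^ e i \<in> ?B" by (auto intro: polys_below_in_adjoin)
  qed (use g_prev in auto)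
  have "h \<in> I"
  proof -
    obtain k where "g (n m) \<in> J k" using g(1) by (auto simp: I_def)
    then have "h \<in> J (max k (n m))"
      unfolding h_def using J_mono[of k "max k (n m)"] J_mono[of "n m" "max k (n m)"] low_J
      by (intro J_diff) auto
    then show ?thesis by (auto simp: I_def)
  qed
  moreover have "h \<notin> J (n m)"
  proof
    assume "h \<in> J (n m)"
    then have "h - (0 - (\<Sum>i<m. u i * x ^ e i * g (n i))) \<in> J (n m)"
      using low_J J_0 by (intro J_diff)
    then show False using g(2) by (simp add: h_def)
  qed
  ultimately have "D (n m) \<le> D (n m) - 1" using h_low D_min by blast
  then show False using D_pos[of "n m"] by simp
qed

lemma sum_apply: "(\<Sum>i\<in>I. f i) x = (\<Sum>i\<in>I. f i x)"
  for f :: "'i \<Rightarrow> 'a \<Rightarrow> 'b::comm_monoid_add"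
  by (induction I rule: infinite_finite_induct) auto

lemma constants_noetherian:
  fixes c :: "'a \<Rightarrow> 'b::field"
  defines "K \<equiv> range (\<lambda>(c::'b) (_::'a). c)"
  shows "is_subring K" "is_noetherian K"
proof -
  show "is_subring K"
    by (auto simp: is_subring_def K_def fun_eq_iff image_iff)
  show "is_noetherian K"
    unfolding is_noetherian_def
  proof (intro allI impI)
    fix f :: "nat \<Rightarrow> 'a \<Rightarrow> 'b" assume "range f \<subseteq> K"
    then have "\<forall>i. \<exists>c. f i = (\<lambda>_. c)" by (auto simp: K_def)
    then obtain a where a: "\<And>i. f i = (\<lambda>_. a i)" by metis
    show "\<exists>m u. range u \<subseteq> K \<and> f m = (\<Sum>i<m. u i * f i)"
    proof (cases "a 0 = 0")
      case True
      then show ?thesis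
        by (intro exI[of _ 0] exI[of _ "\<lambda>_ _. 0"]) (auto simp: a K_def fun_eq_iff)
    next
      case False
      then show ?thesis
        by (intro exI[of _ 1] exI[of _ "\<lambda>_ _. a 1 / a 0"]) (auto simp: a K_def fun_eq_iff)
    qed
  qed
qed

text \<open>The matrix entries are adjoined to the constants one after the other.\<close>
lemma poly_fun_subset_noetherian:
  obtains R :: "(complex^'n^'n \<Rightarrow> complex) set"
  where "is_subring R" "is_noetherian R" "poly_fun \<subseteq> R"
proof -
  define y :: "'n \<times> 'n \<Rightarrow> complex^'n^'n \<Rightarrow> complex" where "y = (\<lambda>(i, j) M. M $ i $ j)"
  let ?K = "range (\<lambda>(c::complex) (_::complex^'n^'n). c)"
  have "\<exists>R. is_subring R \<and> is_noetherian R \<and> ?K \<subseteq> R \<and> y ` T \<subseteq> R" if "finite T" for T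
    using that
  proof (induction T rule: finite_induct)
    case empty
    show ?case by (rule exI[of _ ?K]) (auto simp: constants_noetherian)
  next
    case (insert p T)
    then obtain R where R: "is_subring R" "is_noetherian R" "?K \<subseteq> R" "y ` T \<subseteq> R" by blast
    show ?case
      using R hilbert_basis[OF R(1,2), of "y p"] is_subring_adjoin[OF R(1), of "y p"]
        subset_adjoin[OF R(1), of "y p"] mem_adjoin[OF R(1), of "y p"]
      by (intro exI[of _ "adjoin R (y p)"]) auto
  qed
  from this[OF finite_class.finite_UNIV] obtain R
    where R: "is_subring R" "is_noetherian R" "?K \<subseteq> R" "range y \<subseteq> R" by blast
  have "f \<in> R" if "f \<in> poly_fun" for f
    using that
  proof induction
    case (const c)
    then show ?case using R(3) by auto
  next
    case (entry i j)
    have "y (i, j) \<in> R" using R(4) by blast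
    then show ?case by (simp add: y_def)
  next
    case (add f g)
    then show ?case using subring_add[OF R(1), of f g] by (simp add: plus_fun_def)
  next
    case (mult f g)
    then show ?case using subring_mult[OF R(1), of f g] by (simp add: times_fun_def)
  qed
  with R that show ?thesis by blast
qed

text \<open>For a Zariski closed set this is irreducibility in the Zariski topology; in general it is
  irreducibility of the closure.\<close>
definition irreducible_set :: "(complex^'n^'n) set \<Rightarrow> bool" where
  "irreducible_set Z \<longleftrightarrow> (\<forall>f\<in>poly_fun. \<forall>g\<in>poly_fun.
     (\<forall>M\<in>Z. f M * g M = 0) \<longrightarrow> (\<forall>M\<in>Z. f M = 0) \<or> (\<forall>M\<in>Z. g M = 0))"

lemma irreducible_setD:
  assumes "irreducible_set Z" "f \<in> poly_fun" "g \<in> poly_fun" "\<And>M. M \<in> Z \<Longrightarrow> f M * g M = 0"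
  shows "(\<forall>M\<in>Z. f M = 0) \<or> (\<forall>M\<in>Z. g M = 0)"
  using assms unfolding irreducible_set_def by blast

text \<open>The descending chain condition for Zariski closures: from a strictly increasing chain of
  vanishing ideals pick a new function at every step; the Noetherian property makes one of them a
  combination of earlier ones, hence not new.\<close>
lemma wf_vanishing_ideal:
  "wf {(Z', Z :: (complex^'n^'n) set). vanishing_ideal Z \<subset> vanishing_ideal Z'}"
  unfolding wf_iff_no_infinite_down_chain
proof
  assume "\<exists>Z. \<forall>i. (Z (Suc i), Z i) \<in> {(Z', Z :: (complex^'n^'n) set). vanishing_ideal Z \<subset> vanishing_ideal Z'}"
  then obtain Z :: "nat \<Rightarrow> (complex^'n^'n) set"
    where Z: "\<And>i. vanishing_ideal (Z i) \<subset> vanishing_ideal (Z (Suc i))" by auto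
  have "\<forall>i. \<exists>f. f \<in> vanishing_ideal (Z (Suc i)) \<and> f \<notin> vanishing_ideal (Z i)" using Z by blast
  then obtain f where f: "\<And>i. f i \<in> vanishing_ideal (Z (Suc i))" "\<And>i. f i \<notin> vanishing_ideal (Z i)"
    by metis
  have fp: "f i \<in> poly_fun" for i using f(1)[of i] by (simp add: vanishing_ideal_def)
  obtain R :: "(complex^'n^'n \<Rightarrow> complex) set"
    where R: "is_subring R" "is_noetherian R" "poly_fun \<subseteq> R"
    by (rule poly_fun_subset_noetherian)
  obtain m u where u: "f m = (\<Sum>i<m. u i * f i)"
    using R(2,3) fp unfolding is_noetherian_def by (metis image_subset_iff subsetD)
  have mono: "vanishing_ideal (Z i) \<subseteq> vanishing_ideal (Z k)" if "i \<le> k" for i k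
    by (rule lift_Suc_mono_le[OF _ that]) (use Z in blast)
  have "f m M = 0" if "M \<in> Z m" for M
  proof -
    have "f i M = 0" if "i < m" for i
      using f(1)[of i] mono[of "Suc i" m] that \<open>M \<in> Z m\<close> by (auto simp: vanishing_ideal_def)
    then show ?thesis by (simp add: u sum_apply)
  qed
  with f(2)[of m] fp show False by (auto simp: vanishing_ideal_def)
qed

text \<open>Noetherian induction: a set that is not irreducible is the union of two pieces \<open>f = 0\<close> and \<open>g = 0\<close>
  with strictly larger vanishing ideals.\<close>
lemma finite_irreducible_decomposition:
  "\<exists>\<Z>. finite \<Z> \<and> \<Union>\<Z> = Z \<and> (\<forall>Y\<in>\<Z>. irreducible_set Y)"
proof (induction Z rule: wf_induct_rule[OF wf_vanishing_ideal])
  case (1 Z)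
  show ?case
  proof (cases "irreducible_set Z")
    case True
    then show ?thesis by (intro exI[of _ "{Z}"]) auto
  next
    case False
    then obtain f g where fg: "f \<in> poly_fun" "g \<in> poly_fun" "\<And>M. M \<in> Z \<Longrightarrow> f M * g M = 0"
      "\<exists>M\<in>Z. f M \<noteq> 0" "\<exists>M\<in>Z. g M \<noteq> 0" by (auto simp: irreducible_set_def)
    have step: "\<exists>\<Z>. finite \<Z> \<and> \<Union>\<Z> = {M\<in>Z. h M = 0} \<and> (\<forall>Y\<in>\<Z>. irreducible_set Y)"
      if h: "h \<in> poly_fun" "\<exists>M\<in>Z. h M \<noteq> 0" for h
    proof (rule 1)
      have "h \<in> vanishing_ideal {M\<in>Z. h M = 0} - vanishing_ideal Z"
        using h by (auto simp: vanishing_ideal_def)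
      moreover have "vanishing_ideal Z \<subseteq> vanishing_ideal {M\<in>Z. h M = 0}"
        by (auto simp: vanishing_ideal_def)
      ultimately show "({M\<in>Z. h M = 0}, Z) \<in> {(Z', Z). vanishing_ideal Z \<subset> vanishing_ideal Z'}"
        by blast
    qed
    obtain \<F> \<G> where "finite \<F>" "\<Union>\<F> = {M\<in>Z. f M = 0}" "\<forall>Y\<in>\<F>. irreducible_set Y"
      "finite \<G>" "\<Union>\<G> = {M\<in>Z. g M = 0}" "\<forall>Y\<in>\<G>. irreducible_set Y"
      using step fg by meson
    moreover have "Z = {M\<in>Z. f M = 0} \<union> {M\<in>Z. g M = 0}" using fg(3) by auto
    ultimately show ?thesis by (intro exI[of _ "\<F> \<union> \<G>"]) auto
  qed
qed

section \<open>Algebraic dependence by counting monomials\<close>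

text \<open>The functions into the complex numbers as a complex vector space. The argument below is about
  arbitrary functions; it will be applied to polynomials restricted to a cone.\<close>
definition fscale :: "complex \<Rightarrow> ('a \<Rightarrow> complex) \<Rightarrow> 'a \<Rightarrow> complex" where
  "fscale c f = (\<lambda>x. c * f x)"

global_interpretation fvs: vector_space "fscale :: complex \<Rightarrow> ('a \<Rightarrow> complex) \<Rightarrow> 'a \<Rightarrow> complex"
  by unfold_locales (simp_all add: fscale_def fun_eq_iff algebra_simps)

lemma fscale_mult_right: "f * fscale c g = fscale c (f * g)"
  by (simp add: fscale_def fun_eq_iff)

lemma subspace_mult_preimage:
  assumes "fvs.subspace W"
  shows "fvs.subspace {f. g * f \<in> W}" 
  using assms by (auto simp: fvs.subspace_def distrib_left fscale_mult_right)

lemma mult_span_subset: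
  assumes "f \<in> fvs.span B" "fvs.subspace W" "\<And>b. b \<in> B \<Longrightarrow> g * b \<in> W"
  shows "g * f \<in> W"
proof -
  have "fvs.span B \<subseteq> {f. g * f \<in> W}"
    using assms by (intro fvs.span_minimal subspace_mult_preimage) auto
  with assms(1) show ?thesis by blast
qed

text \<open>More vectors than the dimension of a space containing them satisfy a nontrivial relation. The
  vectors form a family, as repetitions have to count as a relation.\<close>
lemma linear_relation_of_card_gt:
  fixes v :: "'i \<Rightarrow> 'a \<Rightarrow> complex"
  assumes fin: "finite I" "finite S" and card: "card S < card I"
    and span: "\<And>i. i \<in> I \<Longrightarrow> v i \<in> fvs.span S"
  shows "\<exists>c. (\<exists>i\<in>I. c i \<noteq> 0) \<and> (\<Sum>i\<in>I. fscale (c i) (v i)) = 0"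
proof (cases "inj_on v I")
  case True
  have "fvs.dependent (v ` I)"
  proof (rule ccontr)
    assume "fvs.independent (v ` I)"
    then have "card (v ` I) \<le> card S"
      using fvs.independent_span_bound[OF fin(2)] span by blast
    then show False using card card_image[OF True] by simp
  qed
  then obtain u where u: "\<exists>w\<in>v ` I. u w \<noteq> 0" "(\<Sum>w\<in>v ` I. fscale (u w) w) = 0"
    using fvs.dependent_finite[of "v ` I"] fin by auto
  then show ?thesis
    using sum.reindex[OF True, of "\<lambda>w. fscale (u w) w"] by (intro exI[of _ "u \<circ> v"]) auto
next
  case False
  then obtain i j where ij: "i \<in> I" "j \<in> I" "i \<noteq> j" "v i = v j" by (auto simp: inj_on_def)
  define c :: "'i \<Rightarrow> complex" where "c k = (if k = i then 1 else if k = j then -1 else 0)" for k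
  have "(\<Sum>k\<in>I. fscale (c k) (v k)) = (\<Sum>k\<in>{i, j}. fscale (c k) (v k))"
    using ij fin by (intro sum.mono_neutral_right) (auto simp: c_def)
  also have "\<dots> = 0" using ij by (simp add: c_def fscale_def fun_eq_iff)
  finally show ?thesis using ij by (intro exI[of _ c]) (auto simp: c_def)
qed

text \<open>Exponents of the monomials in \<open>k\<close> variables with degree at most \<open>m\<close> in each variable.\<close>
definition exponents :: "nat \<Rightarrow> nat \<Rightarrow> (nat \<Rightarrow> nat) set" where
  "exponents k m = {b. (\<forall>i<k. b i \<le> m) \<and> (\<forall>i\<ge>k. b i = 0)}"

lemma finite_exponents: "finite (exponents k m)" and card_exponents: "card (exponents k m) = (m + 1) ^ k"
proof -
  have bij: "bij_betw (\<lambda>b. restrict b {..<k}) (exponents k m) (PiE {..<k} (\<lambda>_. {..m}))"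
    by (rule bij_betw_byWitness[where f' = "\<lambda>f i. if i < k then f i else 0"])
       (auto simp: exponents_def fun_eq_iff PiE_def extensional_def Pi_def)
  have fin: "finite (PiE {..<k} (\<lambda>_. {..m}))" by (intro finite_PiE) auto
  show "finite (exponents k m)" using bij fin by (simp add: bij_betw_finite)
  show "card (exponents k m) = (m + 1) ^ k"
    using bij_betw_same_card[OF bij] by (simp add: card_PiE)
qed

definition monomial :: "nat \<Rightarrow> (nat \<Rightarrow> 'a \<Rightarrow> complex) \<Rightarrow> (nat \<Rightarrow> nat) \<Rightarrow> 'a \<Rightarrow> complex" where
  "monomial k z b = (\<Prod>i<k. z i ^ b i)"

lemma monomial_mult: "monomial k z b * monomial k z b' = monomial k z (\<lambda>i. b i + b' i)"
  by (simp add: monomial_def prod.distrib power_add)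

text \<open>The module over the polynomials in \<open>z 0, \<dots>, z (e - 1)\<close> generated by \<open>U\<close>, filtered by the degree of
  the coefficients. The filtration matters because the \<open>m\<close>-th piece has dimension at most
  \<open>(m + 1) ^ e * card U\<close>. For \<open>U = {1}\<close> one gets the subalgebra generated by the \<open>z i\<close>.\<close>
definition bounded_module :: "nat \<Rightarrow> (nat \<Rightarrow> 'a \<Rightarrow> complex) \<Rightarrow> ('a \<Rightarrow> complex) set \<Rightarrow> nat \<Rightarrow> ('a \<Rightarrow> complex) set" where
  "bounded_module e z U m = fvs.span ((\<lambda>(b, u). monomial e z b * u) ` (exponents e m \<times> U))"

definition poly_module :: "nat \<Rightarrow> (nat \<Rightarrow> 'a \<Rightarrow> complex) \<Rightarrow> ('a \<Rightarrow> complex) set \<Rightarrow> ('a \<Rightarrow> complex) set" where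
  "poly_module e z U = (\<Union>m. bounded_module e z U m)"

lemma bounded_module_mono: "m \<le> m' \<Longrightarrow> bounded_module e z U m \<subseteq> bounded_module e z U m'"
  unfolding bounded_module_def by (intro fvs.span_mono image_mono) (auto simp: exponents_def intro: le_trans)

lemma bounded_module_subspace: "fvs.subspace (bounded_module e z U m)"
  by (simp add: bounded_module_def)

lemma bounded_module_base: "b \<in> exponents e m \<Longrightarrow> u \<in> U \<Longrightarrow> monomial e z b * u \<in> bounded_module e z U m"
  unfolding bounded_module_def by (intro fvs.span_base) auto

lemma mem_bounded_module: "u \<in> U \<Longrightarrow> u \<in> bounded_module e z U m"
  using bounded_module_base[of "\<lambda>_. 0" e m u U z] by (auto simp: exponents_def monomial_def)

lemma monomial_mult_bounded_module:
  assumes b: "b \<in> exponents e c" and f: "f \<in> bounded_module e z U m"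
  shows "monomial e z b * f \<in> bounded_module e z U (c + m)"
proof (rule mult_span_subset[OF f[unfolded bounded_module_def] bounded_module_subspace])
  fix h assume "h \<in> (\<lambda>(b, u). monomial e z b * u) ` (exponents e m \<times> U)"
  then obtain b' u where h: "b' \<in> exponents e m" "u \<in> U" "h = monomial e z b' * u" by auto
  have "(\<lambda>i. b i + b' i) \<in> exponents e (c + m)" using b h(1) by (auto simp: exponents_def intro: add_mono)
  from bounded_module_base[OF this h(2), of z] show "monomial e z b * h \<in> bounded_module e z U (c + m)"
    by (simp add: h(3) monomial_mult mult.assoc[symmetric])
qed

lemma poly_mult_bounded_module:
  assumes p: "p \<in> bounded_module e z {1} c" and f: "f \<in> bounded_module e z U m"
  shows "p * f \<in> bounded_module e z U (c + m)"
proof -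
  have "f * p \<in> bounded_module e z U (c + m)"
    by (rule mult_span_subset[OF p[unfolded bounded_module_def] bounded_module_subspace])
       (use monomial_mult_bounded_module[OF _ f] in \<open>auto simp: mult.commute\<close>)
  then show ?thesis by (simp add: mult.commute)
qed

lemma poly_module_common:
  assumes "f \<in> poly_module e z U" "g \<in> poly_module e z U"
  obtains m where "f \<in> bounded_module e z U m" "g \<in> bounded_module e z U m"
proof -
  from assms obtain m k where "f \<in> bounded_module e z U m" "g \<in> bounded_module e z U k" by (auto simp: poly_module_def)
  then show ?thesis
    using bounded_module_mono[of m "max m k" e z U] bounded_module_mono[of k "max m k" e z U]
    by (intro that[of "max m k"]) auto
qed

lemma poly_module_I: "f \<in> bounded_module e z U m \<Longrightarrow> f \<in> poly_module e z U"
  by (auto simp: poly_module_def)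

lemma poly_module_add:
  assumes "f \<in> poly_module e z U" "g \<in> poly_module e z U"
  shows "f + g \<in> poly_module e z U"
proof -
  from poly_module_common[OF assms] obtain m where "f \<in> bounded_module e z U m" "g \<in> bounded_module e z U m" .
  from fvs.subspace_add[OF bounded_module_subspace this] show ?thesis by (rule poly_module_I)
qed

lemma poly_module_0: "0 \<in> poly_module e z U"
  using fvs.subspace_0[OF bounded_module_subspace] by (rule poly_module_I)

lemma poly_module_uminus: "f \<in> poly_module e z U \<Longrightarrow> - f \<in> poly_module e z U"
  by (metis UN_E UN_I UNIV_I poly_module_def fvs.subspace_neg[OF bounded_module_subspace])

lemma poly_module_sum:
  "(\<And>i. i \<in> I \<Longrightarrow> f i \<in> poly_module e z U) \<Longrightarrow> (\<Sum>i\<in>I. f i) \<in> poly_module e z U"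
  by (induction I rule: infinite_finite_induct) (auto intro: poly_module_0 poly_module_add)

lemma poly_module_mult:
  assumes "p \<in> poly_module e z {1}" "f \<in> poly_module e z U"
  shows "p * f \<in> poly_module e z U"
  using assms poly_mult_bounded_module by (fastforce simp: poly_module_def)

lemma poly_module_base: "u \<in> U \<Longrightarrow> u \<in> poly_module e z U"
  using mem_bounded_module by (rule poly_module_I)

lemma poly_module_mult_subset:
  assumes "\<And>u. u \<in> U \<Longrightarrow> h * u \<in> poly_module e z U'" "f \<in> poly_module e z U"
  shows "h * f \<in> poly_module e z U'"
proof -
  have sub: "fvs.subspace (poly_module e z U')"
    using poly_module_0 poly_module_add fvs.subspace_scale[OF bounded_module_subspace]
    by (fastforce simp: fvs.subspace_def poly_module_def)
  obtain m where f: "f \<in> bounded_module e z U m" using assms(2) by (auto simp: poly_module_def)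
  show ?thesis
  proof (rule mult_span_subset[OF f[unfolded bounded_module_def] sub])
    fix g assume "g \<in> (\<lambda>(b, u). monomial e z b * u) ` (exponents e m \<times> U)"
    then obtain b u where g: "b \<in> exponents e m" "u \<in> U" "g = monomial e z b * u" by auto
    obtain c where c: "h * u \<in> bounded_module e z U' c" using assms(1)[OF g(2)] by (auto simp: poly_module_def)
    have "monomial e z b * (h * u) \<in> poly_module e z U'"
      using monomial_mult_bounded_module[OF g(1) c] by (rule poly_module_I)
    then show "h * g \<in> poly_module e z U'" by (simp add: g(3) mult.left_commute)
  qed
qed

text \<open>The functions \<open>h\<close> with this property form an algebra, so it can be checked on generators.\<close>
definition bounded_shift where
  "bounded_shift e z U h \<longleftrightarrow> (\<exists>c. \<forall>m. \<forall>f\<in>bounded_module e z U m. h * f \<in> bounded_module e z U (m + c))"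

text \<open>Multiplication by \<open>h\<close> is determined by its effect on the finitely many generators, so the degrees
  needed there bound the shift everywhere.\<close>
lemma bounded_shift_I:
  assumes "finite U" "\<And>u. u \<in> U \<Longrightarrow> h * u \<in> poly_module e z U"
  shows "bounded_shift e z U h"
proof -
  have "\<forall>u\<in>U. \<exists>c. h * u \<in> bounded_module e z U c" using assms by (auto simp: poly_module_def)
  then obtain c where c: "\<And>u. u \<in> U \<Longrightarrow> h * u \<in> bounded_module e z U (c u)" by metis
  define C where "C = (\<Sum>u\<in>U. c u)"
  have C: "h * u \<in> bounded_module e z U C" if "u \<in> U" for u
    using c[OF that] bounded_module_mono[of "c u" C e z U] member_le_sum[of u U c] that assms(1)
    by (auto simp: C_def)
  have "h * f \<in> bounded_module e z U (m + C)" if f: "f \<in> bounded_module e z U m" for f m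
  proof (rule mult_span_subset[OF f[unfolded bounded_module_def] bounded_module_subspace])
    fix g assume "g \<in> (\<lambda>(b, u). monomial e z b * u) ` (exponents e m \<times> U)"
    then obtain b u where g: "b \<in> exponents e m" "u \<in> U" "g = monomial e z b * u" by auto
    show "h * g \<in> bounded_module e z U (m + C)"
      using monomial_mult_bounded_module[OF g(1) C[OF g(2)]] by (simp add: g(3) mult.left_commute)
  qed
  then show ?thesis by (auto simp: bounded_shift_def)
qed

lemma bounded_shift_mult:
  assumes "bounded_shift e z U g" "bounded_shift e z U h"
  shows "bounded_shift e z U (g * h)"
proof -
  obtain c d where "\<And>m f. f \<in> bounded_module e z U m \<Longrightarrow> g * f \<in> bounded_module e z U (m + c)"
     "\<And>m f. f \<in> bounded_module e z U m \<Longrightarrow> h * f \<in> bounded_module e z U (m + d)"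
    using assms unfolding bounded_shift_def by metis
  then show ?thesis unfolding bounded_shift_def
    by (intro exI[of _ "d + c"]) (auto simp: mult.assoc add.assoc[symmetric])
qed

lemma bounded_shift_add:
  assumes "bounded_shift e z U g" "bounded_shift e z U h"
  shows "bounded_shift e z U (g + h)"
proof -
  obtain c d where cd: "\<And>m f. f \<in> bounded_module e z U m \<Longrightarrow> g * f \<in> bounded_module e z U (m + c)"
     "\<And>m f. f \<in> bounded_module e z U m \<Longrightarrow> h * f \<in> bounded_module e z U (m + d)"
    using assms unfolding bounded_shift_def by metis
  have "(g + h) * f \<in> bounded_module e z U (m + (c + d))" if "f \<in> bounded_module e z U m" for f m
    unfolding distrib_right using cd[OF that]
      bounded_module_mono[of "m + c" "m + (c + d)" e z U] bounded_module_mono[of "m + d" "m + (c + d)" e z U]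
    by (intro fvs.subspace_add[OF bounded_module_subspace]) auto
  then show ?thesis by (auto simp: bounded_shift_def)
qed

lemma bounded_shift_const: "bounded_shift e z U (\<lambda>_. c)"
proof -
  have "(\<lambda>_. c) * f = fscale c f" for f :: "'a \<Rightarrow> complex" by (simp add: fscale_def fun_eq_iff)
  then show ?thesis unfolding bounded_shift_def
    by (intro exI[of _ 0]) (simp add: fvs.subspace_scale[OF bounded_module_subspace])
qed

lemma bounded_shift_power: "bounded_shift e z U h \<Longrightarrow> bounded_shift e z U (h ^ k)"
  using bounded_shift_const[of e z U 1]
  by (induction k) (auto intro: bounded_shift_mult simp: one_fun_def)

inductive_set alg_hull :: "('a \<Rightarrow> complex) set \<Rightarrow> ('a \<Rightarrow> complex) set" for Y where
  const: "(\<lambda>_. c) \<in> alg_hull Y"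
| gen: "y \<in> Y \<Longrightarrow> y \<in> alg_hull Y"
| add: "f \<in> alg_hull Y \<Longrightarrow> g \<in> alg_hull Y \<Longrightarrow> f + g \<in> alg_hull Y"
| mult: "f \<in> alg_hull Y \<Longrightarrow> g \<in> alg_hull Y \<Longrightarrow> f * g \<in> alg_hull Y"

text \<open>The element \<open>a\<close> acts as a common denominator: if \<open>a y\<close> maps the module to itself for every generator
  \<open>y\<close>, then every element of the algebra does so after multiplication by a power of \<open>a\<close>.\<close>
lemma bounded_shift_of_alg_hull:
  assumes a: "bounded_shift e z U a" and gen: "\<And>y. y \<in> Y \<Longrightarrow> bounded_shift e z U (a * y)"
    and g: "g \<in> alg_hull Y"
  shows "\<exists>s. bounded_shift e z U (a ^ s * g)"
  using g
proof induction
  case (const c)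
  then show ?case using bounded_shift_const[of e z U c] by (intro exI[of _ 0]) simp
next
  case (gen y)
  from assms(2)[OF this] have "bounded_shift e z U (a ^ 1 * y)" by (simp only: power_one_right)
  then show ?case by blast
next
  case (add f g)
  then obtain s t where "bounded_shift e z U (a ^ s * f)" "bounded_shift e z U (a ^ t * g)" by blast
  then have "bounded_shift e z U (a ^ t * (a ^ s * f) + a ^ s * (a ^ t * g))"
    by (rule bounded_shift_add[OF bounded_shift_mult[OF bounded_shift_power[OF a]]
          bounded_shift_mult[OF bounded_shift_power[OF a]]])
  also have "a ^ t * (a ^ s * f) + a ^ s * (a ^ t * g) = a ^ (s + t) * (f + g)"
    by (simp add: power_add algebra_simps)
  finally show ?case by blast
next
  case (mult f g)
  then obtain s t where "bounded_shift e z U (a ^ s * f)" "bounded_shift e z U (a ^ t * g)" by blast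
  then have "bounded_shift e z U (a ^ s * f * (a ^ t * g))" by (rule bounded_shift_mult)
  also have "a ^ s * f * (a ^ t * g) = a ^ (s + t) * (f * g)"
    by (simp add: power_add algebra_simps)
  finally show ?case by blast
qed

lemma bounded_module_power_shift:
  assumes "\<And>m f. f \<in> bounded_module e z U m \<Longrightarrow> h * f \<in> bounded_module e z U (m + c)" "f \<in> bounded_module e z U m"
  shows "h ^ k * f \<in> bounded_module e z U (m + k * c)"
proof (induction k)
  case (Suc k)
  from assms(1)[OF this] show ?case by (simp only: power_Suc mult.assoc mult_Suc add_ac)
qed (use assms in simp)

lemma alg_hull_power: "f \<in> alg_hull Y \<Longrightarrow> f ^ k \<in> alg_hull Y"
  by (induction k) (auto intro: alg_hull.mult alg_hull.const[of 1, folded one_fun_def])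

lemma alg_hull_prod: "(\<And>i. i \<in> I \<Longrightarrow> f i \<in> alg_hull Y) \<Longrightarrow> (\<Prod>i\<in>I. f i) \<in> alg_hull Y"
  by (induction I rule: infinite_finite_induct)
    (auto intro: alg_hull.mult alg_hull.const[of 1, folded one_fun_def])

lemma alg_hull_scale: "f \<in> alg_hull Y \<Longrightarrow> fscale c f \<in> alg_hull Y"
  using alg_hull.mult[OF alg_hull.const[of c]] by (simp add: fscale_def times_fun_def)

lemma alg_hull_sum: "(\<And>i. i \<in> I \<Longrightarrow> f i \<in> alg_hull Y) \<Longrightarrow> (\<Sum>i\<in>I. f i) \<in> alg_hull Y"
  by (induction I rule: infinite_finite_induct)
    (auto intro: alg_hull.add alg_hull.const[of 0, folded zero_fun_def])

lemma alg_hull_span: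
  assumes "B \<subseteq> alg_hull Y" shows "fvs.span B \<subseteq> alg_hull Y"
  using assms
  by (intro fvs.span_minimal)
     (auto simp: fvs.subspace_def intro: alg_hull.add alg_hull_scale alg_hull.const[of 0, folded zero_fun_def])

lemma poly_module_subset_alg_hull:
  assumes "\<And>i. i < e \<Longrightarrow> z i \<in> alg_hull Y" "U \<subseteq> alg_hull Y"
  shows "poly_module e z U \<subseteq> alg_hull Y"
  unfolding poly_module_def bounded_module_def
  using assms by (intro UN_least alg_hull_span)
    (auto simp: monomial_def intro!: alg_hull.mult alg_hull_prod alg_hull_power)

text \<open>The counting argument. If \<open>a ^ s * g i\<close> shifts degrees by at most \<open>c\<close>, then a fixed power of \<open>a\<close> moves
  all \<open>(n + 1) ^ (e + 1)\<close> monomials in the \<open>g i\<close> with exponents at most \<open>n\<close> into one piece of the filtration,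
  of degree \<open>(e + 1) n c\<close>. The dimension of that piece is of order \<open>n ^ e\<close>, so for large \<open>n\<close> there is a
  linear relation between these monomials, and the power of \<open>a\<close> can be cancelled from it.\<close>
lemma algebraic_relation_of_bounded:
  assumes fin: "finite U" "1 \<in> U" and a: "bounded_shift e z U a" "a \<in> alg_hull Y"
    and gen: "\<And>y. y \<in> Y \<Longrightarrow> bounded_shift e z U (a * y)"
    and nzd: "\<And>h. h \<in> alg_hull Y \<Longrightarrow> a * h = 0 \<Longrightarrow> h = 0"
    and g: "\<And>i. i < Suc e \<Longrightarrow> g i \<in> alg_hull Y"
  shows "\<exists>n c. (\<exists>b\<in>exponents (Suc e) n. c b \<noteq> 0) \<and>
           (\<Sum>b\<in>exponents (Suc e) n. fscale (c b) (monomial (Suc e) g b)) = 0"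
proof -
  have "\<forall>i<Suc e. \<exists>s. bounded_shift e z U (a ^ s * g i)"
    using bounded_shift_of_alg_hull[OF a(1) gen g] by blast
  then obtain s0 where s0: "\<And>i. i < Suc e \<Longrightarrow> bounded_shift e z U (a ^ s0 i * g i)" by metis
  define s where "s = (\<Sum>i<Suc e. s0 i)"
  have s0_le: "s0 i \<le> s" if "i < Suc e" for i
    unfolding s_def using that by (intro member_le_sum) auto
  have gs: "bounded_shift e z U (a ^ s * g i)" if "i < Suc e" for i
  proof -
    have "a ^ s * g i = a ^ (s - s0 i) * (a ^ s0 i * g i)"
      using s0_le[OF that] by (simp add: mult.assoc[symmetric] power_add[symmetric])
    then show ?thesis using s0[OF that] bounded_shift_power[OF a(1)] by (simp add: bounded_shift_mult)
  qed
  then have "\<forall>i<Suc e. \<exists>c. \<forall>m. \<forall>f\<in>bounded_module e z U m. a ^ s * g i * f \<in> bounded_module e z U (m + c)"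
    by (auto simp: bounded_shift_def)
  then obtain c0 where c0: "\<And>i m f. i < Suc e \<Longrightarrow> f \<in> bounded_module e z U m \<Longrightarrow>
      a ^ s * g i * f \<in> bounded_module e z U (m + c0 i)" by metis
  obtain c1 where c1: "\<And>m f. f \<in> bounded_module e z U m \<Longrightarrow> a ^ s * f \<in> bounded_module e z U (m + c1)"
    using bounded_shift_power[OF a(1), of s] by (auto simp: bounded_shift_def)
  define c where "c = (\<Sum>i<Suc e. c0 i) + c1"
  have c0_le: "c0 i \<le> c" if "i < Suc e" for i
    unfolding c_def using that by (intro trans_le_add1 member_le_sum) auto
  have shift_g: "a ^ s * g i * f \<in> bounded_module e z U (m + c)" if "i < Suc e" "f \<in> bounded_module e z U m" for i f m
    using c0[OF that] bounded_module_mono[of "m + c0 i" "m + c" e z U] c0_le[OF that(1)] by auto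
  have shift_a: "a ^ s * f \<in> bounded_module e z U (m + c)" if "f \<in> bounded_module e z U m" for f m
    using c1[OF that] bounded_module_mono[of "m + c1" "m + c" e z U] by (auto simp: c_def)
  have bound: "a ^ (j * n * s) * (\<Prod>i<j. g i ^ b i) \<in> bounded_module e z U (j * n * c)"
    if "j \<le> Suc e" "b \<in> exponents (Suc e) n" for j n b
    using that(1)
  proof (induction j)
    case 0
    show ?case using mem_bounded_module[OF fin(2)]
      by (simp only: mult_0 power_0 mult_1 lessThan_0 prod.empty)
  next
    case (Suc j)
    have bj: "b j \<le> n" using that(2) Suc.prems by (auto simp: exponents_def)
    have 1: "a ^ (j * n * s) * (\<Prod>i<j. g i ^ b i) \<in> bounded_module e z U (j * n * c)"
      by (rule Suc.IH[OF Suc_leD[OF Suc.prems]])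
    have 2: "(a ^ s * g j) ^ b j * (a ^ (j * n * s) * (\<Prod>i<j. g i ^ b i))
        \<in> bounded_module e z U (j * n * c + b j * c)"
      by (rule bounded_module_power_shift[OF shift_g 1]) (use Suc.prems in auto)
    \<comment> \<open>Multiplying by \<open>n - b j\<close> further copies of \<open>a ^ s\<close> makes the power of \<open>a\<close> independent of \<open>b\<close>.\<close>
    have "(a ^ s) ^ (n - b j) * ((a ^ s * g j) ^ b j * (a ^ (j * n * s) * (\<Prod>i<j. g i ^ b i)))
        \<in> bounded_module e z U (j * n * c + b j * c + (n - b j) * c)"
      by (rule bounded_module_power_shift[OF shift_a 2])
    also have "j * n * c + b j * c + (n - b j) * c = j * n * c + (b j + (n - b j)) * c"
      by (simp only: distrib_right add.assoc)
    also have "\<dots> = Suc j * n * c" using bj by (simp add: distrib_right)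
    also have "(a ^ s) ^ (n - b j) * ((a ^ s * g j) ^ b j * (a ^ (j * n * s) * (\<Prod>i<j. g i ^ b i)))
       = ((a ^ s) ^ (n - b j) * (a ^ s) ^ b j) * a ^ (j * n * s) * ((\<Prod>i<j. g i ^ b i) * g j ^ b j)"
      by (simp add: power_mult_distrib mult_ac)
    also have "(a ^ s) ^ (n - b j) * (a ^ s) ^ b j = a ^ (n * s)"
      using bj by (metis le_add_diff_inverse2 power_add power_mult mult.commute)
    also have "a ^ (n * s) * a ^ (j * n * s) = a ^ (Suc j * n * s)"
      by (simp add: power_add[symmetric] algebra_simps)
    finally show ?case by simp
  qed
  define k where "k = Suc e"
  \<comment> \<open>With this \<open>n\<close>, the dimension bound \<open>(k n c + 1) ^ e * card U\<close> is at most \<open>n (n + 1) ^ e\<close>, less than the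
    number of monomials.\<close>
  define n where "n = (k * c + 1) ^ e * card U"
  define S where "S = (\<lambda>(b, u). monomial e z b * u) ` (exponents e (k * n * c) \<times> U)"
  have "card S \<le> card (exponents e (k * n * c) \<times> U)"
    unfolding S_def by (intro card_image_le finite_cartesian_product finite_exponents fin)
  also have "\<dots> = (k * n * c + 1) ^ e * card U" by (simp add: card_cartesian_product card_exponents)
  also have "\<dots> \<le> ((k * c + 1) * (n + 1)) ^ e * card U"
    by (intro mult_right_mono power_mono) (auto simp: algebra_simps)
  also have "\<dots> = n * (n + 1) ^ e" 
    using arg_cong[OF n_def, of "\<lambda>t. t * (n + 1) ^ e"] by (simp only: power_mult_distrib mult_ac)
  also have "\<dots> < (n + 1) ^ Suc e" by simp
  finally have card: "card S < card (exponents (Suc e) n)" by (simp add: card_exponents)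
  have finS: "finite S" unfolding S_def by (intro finite_imageI finite_cartesian_product finite_exponents fin)
  have "a ^ (k * n * s) * monomial (Suc e) g b \<in> fvs.span S" if "b \<in> exponents (Suc e) n" for b
    using bound[OF _ that, of k] by (simp add: k_def S_def bounded_module_def monomial_def)
  then have "\<exists>d. (\<exists>b\<in>exponents (Suc e) n. d b \<noteq> 0) \<and>
     (\<Sum>b\<in>exponents (Suc e) n. fscale (d b) (a ^ (k * n * s) * monomial (Suc e) g b)) = 0"
    by (rule linear_relation_of_card_gt[OF finite_exponents finS card])
  then obtain d where
    d: "\<exists>b\<in>exponents (Suc e) n. d b \<noteq> 0"
       "(\<Sum>b\<in>exponents (Suc e) n. fscale (d b) (a ^ (k * n * s) * monomial (Suc e) g b)) = 0" by blast
  define h where "h = (\<Sum>b\<in>exponents (Suc e) n. fscale (d b) (monomial (Suc e) g b))"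
  have ah: "a ^ (k * n * s) * h = 0"
    unfolding h_def using d(2) by (simp add: sum_distrib_left fscale_mult_right)
  have hA: "h \<in> alg_hull Y"
    unfolding h_def monomial_def
    by (intro alg_hull_sum alg_hull_scale alg_hull_prod alg_hull_power g) auto
  have cancel: "h = 0" if "a ^ t * h = 0" for t
    using that
  proof (induction t)
    case (Suc t)
    have "a ^ t * h \<in> alg_hull Y" by (intro alg_hull.mult alg_hull_power a hA)
    moreover have "a * (a ^ t * h) = 0" using Suc.prems by (simp only: power_Suc mult.assoc)
    ultimately show ?case using nzd Suc.IH by blast
  qed simp
  show ?thesis using d(1) cancel[OF ah] unfolding h_def by blast
qed

text \<open>For one algebraic element \<open>y\<close> of degree \<open>D\<close> with leading coefficient \<open>q D\<close>, the powers \<open>y ^ l\<close> with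
  \<open>l < D\<close> generate a module that \<open>q D * y\<close> maps to itself. For several elements one multiplies the
  generators, and the denominators, together.\<close>
lemma bounding_module:
  assumes fin: "finite Y'" "Y' \<subseteq> alg_hull Y"
    and dom: "\<And>f g. f \<in> alg_hull Y \<Longrightarrow> g \<in> alg_hull Y \<Longrightarrow> f * g = 0 \<Longrightarrow> f = 0 \<or> g = 0"
    and nontriv: "(1 :: 'a \<Rightarrow> complex) \<noteq> 0"
    and z: "\<And>i. i < e \<Longrightarrow> z i \<in> alg_hull (Y :: ('a \<Rightarrow> complex) set)"
    and alg: "\<And>y. y \<in> Y' \<Longrightarrow> \<exists>D q. (\<forall>l\<le>D. q l \<in> poly_module e z {1}) \<and> q D \<noteq> 0 \<and>
                 (\<Sum>l\<le>D. q l * y ^ l) = 0"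
  shows "\<exists>U a. finite U \<and> 1 \<in> U \<and> a \<in> poly_module e z {1} \<and> a \<noteq> 0 \<and>
           (\<forall>y\<in>Y'. \<forall>u\<in>U. a * y * u \<in> poly_module e z U)"
  using fin alg
proof (induction Y' rule: finite_induct)
  case empty
  show ?case
  proof (intro exI conjI)
    show "finite {1 :: 'a \<Rightarrow> complex}" "(1 :: 'a \<Rightarrow> complex) \<in> {1}" by auto
    show "1 \<in> poly_module e z {1}" by (rule poly_module_base) simp
  qed (rule nontriv, blast)
next
  case (insert y Y')
  have "\<exists>U a. finite U \<and> 1 \<in> U \<and> a \<in> poly_module e z {1} \<and> a \<noteq> 0 \<and>
           (\<forall>y\<in>Y'. \<forall>u\<in>U. a * y * u \<in> poly_module e z U)"
    by (rule insert.IH) (use insert.prems in blast)+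
  then obtain U a where U: "finite U" "1 \<in> U" "a \<in> poly_module e z {1}" "a \<noteq> 0"
    "\<And>y' u. y' \<in> Y' \<Longrightarrow> u \<in> U \<Longrightarrow> a * y' * u \<in> poly_module e z U" by blast
  obtain D q where q: "\<And>l. l \<le> D \<Longrightarrow> q l \<in> poly_module e z {1}" "q D \<noteq> 0" "(\<Sum>l\<le>D. q l * y ^ l) = 0"
    using insert.prems(2)[of y] by blast
  have "D \<noteq> 0" using q by (intro notI) auto
  define V where "V = (\<lambda>(u, l). u * y ^ l) ` (U \<times> {..<D})"
  have V: "u * y ^ l \<in> poly_module e z V" if "u \<in> U" "l < D" for u l
    using that by (intro poly_module_base) (auto simp: V_def)
  have hull: "poly_module e z {1} \<subseteq> alg_hull Y"
    using z by (intro poly_module_subset_alg_hull) (auto intro: alg_hull.const[of 1, folded one_fun_def])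
  have rel: "q D * y ^ D = - (\<Sum>l<D. q l * y ^ l)"
    using q(3) by (simp add: lessThan_Suc_atMost[symmetric] eq_neg_iff_add_eq_0 add.commute)
  show ?case
  proof (intro exI[of _ V] exI[of _ "a * q D"] conjI ballI)
    show "finite V" using U(1) by (simp add: V_def)
    have "1 * y ^ 0 \<in> V" unfolding V_def using U(2) \<open>D \<noteq> 0\<close> by (intro image_eqI[of _ _ "(1, 0)"]) auto
    then show "1 \<in> V" by simp
    show "a * q D \<in> poly_module e z {1}" using U(3) q(1) by (intro poly_module_mult) auto
    show "a * q D \<noteq> 0" using dom[of a "q D"] U(3,4) q(1)[of D] q(2) hull by auto
    fix y' w assume y': "y' \<in> insert y Y'" and "w \<in> V"
    then obtain u l where w: "u \<in> U" "l < D" "w = u * y ^ l" by (auto simp: V_def)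
    show "a * q D * y' * w \<in> poly_module e z V"
    proof (cases "y' = y")
      case False
      with y' have "a * y' * u \<in> poly_module e z U" using U(5) w(1) by auto
      then have "y ^ l * (a * y' * u) \<in> poly_module e z V"
        by (rule poly_module_mult_subset[rotated]) (use V w(2) in \<open>simp add: mult.commute\<close>)
      then have "q D * (y ^ l * (a * y' * u)) \<in> poly_module e z V"
        by (rule poly_module_mult[OF q(1)[OF order_refl]])
      then show ?thesis by (simp add: w(3) mult_ac)
    next
      case True
      have "q D * (u * y ^ Suc l) \<in> poly_module e z V"
      proof (cases "Suc l < D")
        case True
        then show ?thesis using q(1) w(1) by (intro poly_module_mult V) auto
      next
        case False
        then have "Suc l = D" using w(2) by simp
        then have "q D * (u * y ^ Suc l) = u * (q D * y ^ D)" by (simp add: mult.left_commute)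
        also have "\<dots> = - (\<Sum>l<D. q l * (u * y ^ l))"
          unfolding rel by (simp add: sum_distrib_left mult.left_commute)
        also have "\<dots> \<in> poly_module e z V"
          using q(1) w(1) by (intro poly_module_uminus poly_module_sum poly_module_mult V) auto
        finally show ?thesis .
      qed
      then have "a * (q D * (u * y ^ Suc l)) \<in> poly_module e z V"
        by (rule poly_module_mult[OF U(3)])
      then show ?thesis by (simp add: True w(3) mult_ac)
    qed
  qed
qed

text \<open>The part of the theory of transcendence degree that is needed: a finitely generated domain that
  is algebraic over \<open>e\<close> of its elements has transcendence degree at most \<open>e\<close>.\<close>
theorem algebraic_relation_of_algebraic_generators:
  fixes Y :: "('a \<Rightarrow> complex) set"
  assumes fin: "finite Y"
    and dom: "\<And>f g. f \<in> alg_hull Y \<Longrightarrow> g \<in> alg_hull Y \<Longrightarrow> f * g = 0 \<Longrightarrow> f = 0 \<or> g = 0"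
    and z: "\<And>i. i < e \<Longrightarrow> z i \<in> alg_hull Y"
    and alg: "\<And>y. y \<in> Y \<Longrightarrow> \<exists>D q. (\<forall>l\<le>D. q l \<in> poly_module e z {1}) \<and> q D \<noteq> 0 \<and>
                 (\<Sum>l\<le>D. q l * y ^ l) = 0"
    and g: "\<And>i. i < Suc e \<Longrightarrow> g i \<in> alg_hull Y"
  shows "\<exists>n c. (\<exists>b\<in>exponents (Suc e) n. c b \<noteq> 0) \<and>
           (\<Sum>b\<in>exponents (Suc e) n. fscale (c b) (monomial (Suc e) g b)) = 0"
proof -
  have one: "(1 :: 'a \<Rightarrow> complex) \<noteq> 0" by (simp add: fun_eq_iff)
  obtain U a where U: "finite U" "1 \<in> U" "a \<in> poly_module e z {1}" "a \<noteq> 0"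
    "\<And>y u. y \<in> Y \<Longrightarrow> u \<in> U \<Longrightarrow> a * y * u \<in> poly_module e z U"
    using bounding_module[OF fin subsetI[OF alg_hull.gen] dom one z alg] by blast
  have hull: "poly_module e z {1} \<subseteq> alg_hull Y"
    using z by (intro poly_module_subset_alg_hull) (auto intro: alg_hull.const[of 1, folded one_fun_def])
  show ?thesis
  proof (rule algebraic_relation_of_bounded[OF U(1,2) _ _ _ _ g])
    show "bounded_shift e z U a"
      using U by (intro bounded_shift_I poly_module_mult[OF U(3)] poly_module_base)
    show "a \<in> alg_hull Y" using U(3) hull by auto
    show "bounded_shift e z U (a * y)" if "y \<in> Y" for y
      using U that by (intro bounded_shift_I)
    show "h = 0" if "h \<in> alg_hull Y" "a * h = 0" for h
      using dom[of a h] that U(3,4) hull by auto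
  qed auto
qed

section \<open>Polynomial functions and homogenization\<close>

lemma poly_fun_sum: "(\<And>i. i \<in> I \<Longrightarrow> f i \<in> poly_fun) \<Longrightarrow> (\<lambda>M. \<Sum>i\<in>I. f i M) \<in> poly_fun"
  by (induction I rule: infinite_finite_induct) (auto intro: poly_fun.intros)

lemma poly_fun_prod: "(\<And>i. i \<in> I \<Longrightarrow> f i \<in> poly_fun) \<Longrightarrow> (\<lambda>M. \<Prod>i\<in>I. f i M) \<in> poly_fun"
  by (induction I rule: infinite_finite_induct) (auto intro: poly_fun.intros)

lemma poly_fun_power: "f \<in> poly_fun \<Longrightarrow> (\<lambda>M. f M ^ k) \<in> poly_fun"
  by (induction k) (auto intro: poly_fun.intros)

lemma poly_fun_scale: "f \<in> poly_fun \<Longrightarrow> (\<lambda>M. c * f M) \<in> poly_fun"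
  by (intro poly_fun.mult poly_fun.const)

lemma poly_fun_diff: "f \<in> poly_fun \<Longrightarrow> g \<in> poly_fun \<Longrightarrow> (\<lambda>M. f M - g M) \<in> poly_fun"
  using poly_fun.add[of f "\<lambda>M. (-1) * g M"] poly_fun_scale[of g "-1"] by simp

lemma cscale_entry [simp]: "cscale c M $ i $ j = c * M $ i $ j"
  by (simp add: cscale_def)

lemma poly_fun_comp_cscale: "f \<in> poly_fun \<Longrightarrow> (\<lambda>M. f (cscale c M)) \<in> poly_fun"
proof (induction rule: poly_fun.induct)
  case (entry i j)
  show ?case using poly_fun.mult[OF poly_fun.const[of c] poly_fun.entry[of i j]] by simp
qed (auto intro: poly_fun.intros)

lemma hom_poly_fun_D:
  "f \<in> hom_poly_fun k \<Longrightarrow> f \<in> poly_fun" "f \<in> hom_poly_fun k \<Longrightarrow> f (cscale c M) = c ^ k * f M"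
  by (auto simp: hom_poly_fun_def)

lemma hom_poly_fun_entry: "(\<lambda>M. M $ i $ j) \<in> hom_poly_fun 1"
  by (auto simp: hom_poly_fun_def intro: poly_fun.entry)

lemma hom_poly_fun_mult:
  "f \<in> hom_poly_fun k \<Longrightarrow> g \<in> hom_poly_fun l \<Longrightarrow> (\<lambda>M. f M * g M) \<in> hom_poly_fun (k + l)"
  by (auto simp: hom_poly_fun_def power_add intro: poly_fun.mult)

lemma hom_poly_fun_power: "f \<in> hom_poly_fun k \<Longrightarrow> (\<lambda>M. f M ^ l) \<in> hom_poly_fun (k * l)"
  by (auto simp: hom_poly_fun_def power_mult power_mult_distrib intro: poly_fun_power)

lemma hom_poly_fun_sum:
  "(\<And>i. i \<in> I \<Longrightarrow> f i \<in> hom_poly_fun k) \<Longrightarrow> (\<lambda>M. \<Sum>i\<in>I. f i M) \<in> hom_poly_fun k"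
  by (auto simp: hom_poly_fun_def sum_distrib_left intro!: poly_fun_sum)

lemma hom_poly_fun_zero: "(\<lambda>M. 0) \<in> hom_poly_fun k"
  by (auto simp: hom_poly_fun_def intro: poly_fun.const)

lemma hom_poly_fun_det: "(det :: complex^'n^'n \<Rightarrow> complex) \<in> hom_poly_fun CARD('n)"
proof -
  have "(\<lambda>M :: complex^'n^'n. \<Sum>p\<in>{p. p permutes UNIV}. of_int (sign p) * (\<Prod>i\<in>UNIV. M $ i $ p i))
      \<in> poly_fun"
    by (intro poly_fun_sum poly_fun_scale poly_fun_prod poly_fun.entry)
  then have "(det :: complex^'n^'n \<Rightarrow> complex) \<in> poly_fun" by (simp add: det_def[abs_def])
  then show ?thesis
    by (auto simp: hom_poly_fun_def det_def prod.distrib sum_distrib_left mult_ac)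
qed

lemma trace_mult_eq: "trace (S ** M) = (\<Sum>i\<in>UNIV. \<Sum>j\<in>UNIV. S $ i $ j * M $ j $ i)"
  by (simp add: trace_def matrix_matrix_mult_def)

lemma hom_poly_fun_trace: "(\<lambda>M. trace (S ** M)) \<in> hom_poly_fun 1"
  by (auto simp: hom_poly_fun_def trace_mult_eq sum_distrib_left mult_ac
      intro!: poly_fun_sum poly_fun.mult poly_fun.const poly_fun.entry)

lemma trace_mult_linear:
  "trace (S ** (M + N)) = trace (S ** M) + trace (S ** N)"
  "trace (S ** cscale c M) = c * trace (S ** M)"
  by (simp_all add: trace_mult_eq sum.distrib distrib_left sum_distrib_left mult_ac)

text \<open>Collecting the homogeneous components of \<open>f\<close> as the coefficients of a polynomial in the scaling
  parameter turns products of functions into products of polynomials, so that the product of two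
  nonzero expansions is nonzero for free.\<close>
lemma homogeneous_expansion:
  assumes "f \<in> poly_fun"
  obtains P :: "complex^'n^'n \<Rightarrow> complex poly" and d
  where "\<And>M t. f (cscale t M) = poly (P M) t"
    "\<And>k. (\<lambda>M. coeff (P M) k) \<in> hom_poly_fun k" "\<And>M. degree (P M) \<le> d"
proof -
  have "\<exists>(P :: complex^'n^'n \<Rightarrow> complex poly) d. (\<forall>M t. f (cscale t M) = poly (P M) t) \<and>
     (\<forall>k. (\<lambda>M. coeff (P M) k) \<in> hom_poly_fun k) \<and> (\<forall>M. degree (P M) \<le> d)"
    using assms
  proof induction
    case (const c)
    show ?case
      by (intro exI[of _ "\<lambda>_. [:c:]"] exI[of _ 0])
         (auto simp: hom_poly_fun_def coeff_pCons split: nat.splits intro: poly_fun.const)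
  next
    case (entry i j)
    have "(\<lambda>M :: complex^'n^'n. coeff (monom (M $ i $ j) 1) k) \<in> hom_poly_fun k" for k
      using hom_poly_fun_entry[of i j] hom_poly_fun_zero[of k] by (cases "k = 1") auto
    then show ?case
      by (intro exI[of _ "\<lambda>M. monom (M $ i $ j) 1"] exI[of _ 1])
         (auto simp: poly_monom degree_monom_le)
  next
    case (add f g)
    then obtain P d Q e where
      "(\<forall>M t. f (cscale t M) = poly (P M) t) \<and>
        (\<forall>k. (\<lambda>M. coeff (P M) k) \<in> hom_poly_fun k) \<and> (\<forall>M. degree (P M) \<le> d)"
      "(\<forall>M t. g (cscale t M) = poly (Q M) t) \<and>
        (\<forall>k. (\<lambda>M. coeff (Q M) k) \<in> hom_poly_fun k) \<and> (\<forall>M. degree (Q M) \<le> e)" by blast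
    then show ?case
      by (intro exI[of _ "\<lambda>M. P M + Q M"] exI[of _ "max d e"])
         (auto simp: hom_poly_fun_def distrib_left intro!: poly_fun.add degree_add_le
           intro: le_trans max.coboundedI1 max.coboundedI2)
  next
    case (mult f g)
    then obtain P d Q e where PQ:
      "(\<forall>M t. f (cscale t M) = poly (P M) t) \<and>
        (\<forall>k. (\<lambda>M. coeff (P M) k) \<in> hom_poly_fun k) \<and> (\<forall>M. degree (P M) \<le> d)"
      "(\<forall>M t. g (cscale t M) = poly (Q M) t) \<and>
        (\<forall>k. (\<lambda>M. coeff (Q M) k) \<in> hom_poly_fun k) \<and> (\<forall>M. degree (Q M) \<le> e)" by blast
    show ?case
    proof (intro exI[of _ "\<lambda>M. P M * Q M"] exI[of _ "d + e"] conjI allI)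
      show "degree (P M * Q M) \<le> d + e" for M
        using PQ degree_mult_le[of "P M" "Q M"] by (meson add_mono le_trans)
      show "(\<lambda>M. coeff (P M * Q M) k) \<in> hom_poly_fun k" for k
        unfolding coeff_mult
      proof (rule hom_poly_fun_sum)
        fix i assume "i \<in> {..k}"
        then show "(\<lambda>M. coeff (P M) i * coeff (Q M) (k - i)) \<in> hom_poly_fun k"
          using hom_poly_fun_mult[of "\<lambda>M. coeff (P M) i" i "\<lambda>M. coeff (Q M) (k - i)" "k - i"] PQ
          by simp
      qed
    qed (use PQ in auto)
  qed
  then show ?thesis using that by blast
qed

lemma homogenization:
  assumes "f \<in> poly_fun"
  obtains d F where "F \<in> hom_poly_fun d" "\<And>M :: complex^'n^'n. M $ i $ j = 1 \<Longrightarrow> F M = f M"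
proof -
  obtain P d where P: "\<And>M t. f (cscale t M) = poly (P M) t"
    "\<And>k. (\<lambda>M. coeff (P M) k) \<in> hom_poly_fun k" "\<And>M. degree (P M) \<le> d"
    by (rule homogeneous_expansion[OF assms]) blast
  define F where "F M = (\<Sum>k\<le>d. M $ i $ j ^ (d - k) * coeff (P M) k)" for M
  have "F \<in> hom_poly_fun d"
    unfolding F_def[abs_def]
  proof (rule hom_poly_fun_sum)
    fix k assume "k \<in> {..d}"
    then show "(\<lambda>M. M $ i $ j ^ (d - k) * coeff (P M) k) \<in> hom_poly_fun d"
      using hom_poly_fun_mult[OF hom_poly_fun_power[OF hom_poly_fun_entry[of i j], of "d - k"] P(2)[of k]]
      by simp
  qed
  moreover have "F M = f M" if "M $ i $ j = 1" for M
  proof -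
    have "f M = poly (P M) 1" using P(1)[of 1 M] by simp
    also have "\<dots> = (\<Sum>k\<le>d. coeff (P M) k)" 
      unfolding poly_altdef using P(3)[of M]
      by (intro sum.mono_neutral_cong_left) (auto intro: coeff_eq_0)
    finally show ?thesis using that by (simp add: F_def)
  qed
  ultimately show ?thesis by (rule that)
qed

lemma poly_fun_on_line:
  assumes "f \<in> poly_fun"
  shows "\<exists>p. \<forall>t. f (M + cscale t v) = poly p t"
  using assms
proof induction
  case (const c)
  show ?case by (intro exI[of _ "[:c:]"]) simp
next
  case (entry i j)
  show ?case by (intro exI[of _ "[:M $ i $ j, v $ i $ j:]"]) simp
next
  case (add f g)
  then obtain p q where "\<forall>t. f (M + cscale t v) = poly p t" "\<forall>t. g (M + cscale t v) = poly q t"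
    by blast
  then show ?case by (intro exI[of _ "p + q"]) simp
next
  case (mult f g)
  then obtain p q where "\<forall>t. f (M + cscale t v) = poly p t" "\<forall>t. g (M + cscale t v) = poly q t"
    by blast
  then show ?case by (intro exI[of _ "p * q"]) simp
qed

section \<open>Directional derivatives\<close>

text \<open>The directional derivative is linear in the direction; it is stated with a coefficient matrix so
  that the induction over the structure of \<open>f\<close> is a computation with the product rule.\<close>
lemma poly_fun_gradient:
  assumes "f \<in> poly_fun"
  shows "\<exists>G. \<forall>v. ((\<lambda>t. f (M + cscale t v)) has_field_derivative
            (\<Sum>i\<in>UNIV. \<Sum>j\<in>UNIV. G i j * v $ i $ j)) (at 0)"
  using assms
proof induction
  case (const c)
  show ?case by (intro exI[of _ "\<lambda>_ _. 0"]) auto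
next
  case (entry i j)
  have "(\<Sum>a\<in>UNIV. \<Sum>b\<in>UNIV. (if a = i \<and> b = j then 1 else 0) * v $ a $ b) = v $ i $ j"
    for v :: "complex^'a^'a"
  proof -
    have "(\<Sum>a\<in>UNIV. \<Sum>b\<in>UNIV. (if a = i \<and> b = j then 1 else 0) * v $ a $ b)
        = (\<Sum>a\<in>UNIV. if a = i then \<Sum>b\<in>UNIV. if b = j then v $ a $ b else 0 else 0)"
      by (intro sum.cong refl) (simp add: if_distrib[of "\<lambda>c. c * _"] cong: if_cong)
    then show ?thesis by simp
  qed
  then show ?case
    by (intro exI[of _ "\<lambda>a b. if a = i \<and> b = j then 1 else 0"])
       (auto intro!: derivative_eq_intros)
next
  case (add f g)
  then obtain F G where "\<And>v. ((\<lambda>t. f (M + cscale t v)) has_field_derivative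
            (\<Sum>i\<in>UNIV. \<Sum>j\<in>UNIV. F i j * v $ i $ j)) (at 0)"
    "\<And>v. ((\<lambda>t. g (M + cscale t v)) has_field_derivative
            (\<Sum>i\<in>UNIV. \<Sum>j\<in>UNIV. G i j * v $ i $ j)) (at 0)" by blast
  from DERIV_add[OF this] show ?case
    by (intro exI[of _ "\<lambda>i j. F i j + G i j"]) (simp add: sum.distrib distrib_right)
next
  case (mult f g)
  then obtain F G where F: "\<And>v. ((\<lambda>t. f (M + cscale t v)) has_field_derivative
            (\<Sum>i\<in>UNIV. \<Sum>j\<in>UNIV. F i j * v $ i $ j)) (at 0)"
    and G: "\<And>v. ((\<lambda>t. g (M + cscale t v)) has_field_derivative
            (\<Sum>i\<in>UNIV. \<Sum>j\<in>UNIV. G i j * v $ i $ j)) (at 0)" by blast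
  have "((\<lambda>t. f (M + cscale t v) * g (M + cscale t v)) has_field_derivative
         (\<Sum>i\<in>UNIV. \<Sum>j\<in>UNIV. (F i j * g M + G i j * f M) * v $ i $ j)) (at 0)" for v
    using DERIV_mult[OF F[of v] G[of v]]
    by (simp add: sum.distrib distrib_right distrib_left sum_distrib_right sum_distrib_left mult_ac)
  then show ?case by (intro exI[of _ "\<lambda>i j. F i j * g M + G i j * f M"]) blast
qed

lemma has_dir_deriv:
  assumes "f \<in> poly_fun"
  shows "((\<lambda>t. f (M + cscale t v)) has_field_derivative dir_deriv f M v) (at 0)"
proof -
  obtain D where "((\<lambda>t. f (M + cscale t v)) has_field_derivative D) (at 0)"
    using poly_fun_gradient[OF assms, of M] by blast
  then show ?thesis unfolding dir_deriv_def using DERIV_imp_deriv by blast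
qed

lemma dir_deriv_eqI:
  "((\<lambda>t. f (M + cscale t v)) has_field_derivative D) (at 0) \<Longrightarrow> dir_deriv f M v = D"
  unfolding dir_deriv_def by (rule DERIV_imp_deriv)

lemma dir_deriv_linear:
  assumes "f \<in> poly_fun"
  shows "dir_deriv f M (v + w) = dir_deriv f M v + dir_deriv f M w"
    "dir_deriv f M (cscale c v) = c * dir_deriv f M v"
    "dir_deriv f M 0 = 0"
proof -
  obtain G where "\<forall>v. ((\<lambda>t. f (M + cscale t v)) has_field_derivative
            (\<Sum>i\<in>UNIV. \<Sum>j\<in>UNIV. G i j * v $ i $ j)) (at 0)"
    using poly_fun_gradient[OF assms, of M] by blast
  then have "\<And>v. dir_deriv f M v = (\<Sum>i\<in>UNIV. \<Sum>j\<in>UNIV. G i j * v $ i $ j)"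
    by (blast intro: dir_deriv_eqI)
  then show "dir_deriv f M (v + w) = dir_deriv f M v + dir_deriv f M w"
    "dir_deriv f M (cscale c v) = c * dir_deriv f M v" "dir_deriv f M 0 = 0"
    by (simp_all add: sum.distrib distrib_left sum_distrib_left mult_ac)
qed

lemma dir_deriv_mult:
  assumes "f \<in> poly_fun" "g \<in> poly_fun"
  shows "dir_deriv (\<lambda>M. f M * g M) M v = dir_deriv f M v * g M + dir_deriv g M v * f M"
  using DERIV_mult[OF has_dir_deriv[OF assms(1)] has_dir_deriv[OF assms(2)], of M v M v]
  by (intro dir_deriv_eqI) simp

lemma dir_deriv_diff:
  assumes "f \<in> poly_fun" "g \<in> poly_fun"
  shows "dir_deriv (\<lambda>M. f M - g M) M v = dir_deriv f M v - dir_deriv g M v"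
  using DERIV_diff[OF has_dir_deriv[OF assms(1)] has_dir_deriv[OF assms(2)], of M v M v]
  by (intro dir_deriv_eqI) simp

lemma dir_deriv_divide:
  assumes "f \<in> poly_fun" "g \<in> poly_fun" "g M \<noteq> 0"
  shows "dir_deriv (\<lambda>M. f M / g M) M v = (dir_deriv f M v * g M - f M * dir_deriv g M v) / (g M * g M)"
  using DERIV_divide[OF has_dir_deriv[OF assms(1)] has_dir_deriv[OF assms(2)], of M v M v] assms(3)
  by (intro dir_deriv_eqI) simp

lemma dir_deriv_trace_power:
  "dir_deriv (\<lambda>M. trace (S ** M) ^ k) M v = of_nat k * trace (S ** M) ^ (k - 1) * trace (S ** v)"
  by (rule dir_deriv_eqI) (auto simp: trace_mult_linear intro!: derivative_eq_intros)

lemma cscale_one_plus: "M + cscale t M = cscale (1 + t) M"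
  by (simp add: cmat.scale_left_distrib)

text \<open>Euler's formula.\<close>
lemma dir_deriv_self:
  assumes "f \<in> hom_poly_fun k"
  shows "dir_deriv f M M = of_nat k * f M"
  using hom_poly_fun_D(2)[OF assms]
  by (intro dir_deriv_eqI) (auto simp: cscale_one_plus intro!: derivative_eq_intros)

lemma dir_deriv_cscale:
  assumes "f \<in> poly_fun"
  shows "dir_deriv (\<lambda>M. f (cscale c M)) M v = c * dir_deriv f (cscale c M) v"
proof -
  have "dir_deriv (\<lambda>M. f (cscale c M)) M v = dir_deriv f (cscale c M) (cscale c v)"
    unfolding dir_deriv_def by (simp add: cmat.scale_right_distrib mult.commute)
  then show ?thesis using dir_deriv_linear(2)[OF assms] by simp
qed

lemma subspace_tangent_space: "cmat.subspace (tangent_space V M)"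
  by (auto simp: cmat.subspace_def tangent_space_def vanishing_ideal_def dir_deriv_linear)

section \<open>The cone over a projective set\<close>

lemma finite_dimensional_matrices: "\<exists>B :: (complex^'n^'n) set. finite B \<and> cmat.span B = UNIV"
proof -
  define E :: "'n \<times> 'n \<Rightarrow> complex^'n^'n" where
    "E = (\<lambda>(i, j). \<chi> a b. if a = i \<and> b = j then 1 else 0)"
  have "M \<in> cmat.span (range E)" for M
  proof -
    have "M = (\<Sum>p\<in>UNIV. cscale (M $ fst p $ snd p) (E p))"
    proof -
      have "(\<Sum>p\<in>UNIV. cscale (M $ fst p $ snd p) (E p)) $ a $ b = M $ a $ b" for a b
      proof -
        have "(\<Sum>p\<in>UNIV. cscale (M $ fst p $ snd p) (E p)) $ a $ b
            = (\<Sum>p\<in>UNIV. if p = (a, b) then M $ a $ b else 0)"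
          unfolding sum_component by (intro sum.cong refl) (simp add: E_def split: prod.splits)
        then show ?thesis by simp
      qed
      then show ?thesis by (simp add: vec_eq_iff)
    qed
    also have "\<dots> \<in> cmat.span (range E)" by (intro cmat.span_sum cmat.span_scale cmat.span_base) auto
    finally show ?thesis .
  qed
  then show ?thesis by (intro exI[of _ "range E"]) auto
qed

lemma independent_finite:
  fixes B :: "(complex^'n^'n) set" shows "cmat.independent B \<Longrightarrow> finite B"
proof -
  assume B: "cmat.independent B"
  obtain A :: "(complex^'n^'n) set" where "finite A" "cmat.span A = UNIV"
    using finite_dimensional_matrices by blast
  with cmat.independent_span_bound[OF this(1) B] show "finite B" by auto
qed

text \<open>A basis of the hyperplane section is extended by \<open>M\<close>.\<close>
lemma dim_eq_Suc_dim_hyperplane: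
  assumes T: "cmat.subspace T" and M: "M \<in> T" "M $ i $ j = 1"
  shows "cmat.dim T = Suc (cmat.dim {v\<in>T. v $ i $ j = 0})"
proof -
  let ?H = "{v\<in>T. v $ i $ j = 0}"
  have H: "cmat.subspace ?H" using T by (auto simp: cmat.subspace_def)
  obtain B where B: "B \<subseteq> ?H" "cmat.independent B" "?H \<subseteq> cmat.span B" "card B = cmat.dim ?H"
    using cmat.basis_exists by blast
  have spanB: "cmat.span B = ?H" using cmat.span_minimal[OF B(1) H] B(3) by blast
  then have notin: "M \<notin> cmat.span B" using M by auto
  then have ind: "cmat.independent (insert M B)" using B(2) by (simp add: cmat.independent_insert)
  have "T \<subseteq> cmat.span (insert M B)"
  proof
    fix v assume v: "v \<in> T"
    have "v - cscale (v $ i $ j) M \<in> ?H"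
      using v M T by (auto intro: cmat.subspace_diff cmat.subspace_scale)
    then have "v - cscale (v $ i $ j) M \<in> cmat.span (insert M B)"
      using spanB cmat.span_mono[of B "insert M B"] by blast
    moreover have "cscale (v $ i $ j) M \<in> cmat.span (insert M B)"
      by (intro cmat.span_scale cmat.span_base) auto
    ultimately have "(v - cscale (v $ i $ j) M) + cscale (v $ i $ j) M \<in> cmat.span (insert M B)"
      by (rule cmat.span_add)
    then show "v \<in> cmat.span (insert M B)" by simp
  qed
  then have "cmat.dim T = card (insert M B)"
    using ind B(1) M(1) by (intro cmat.dim_unique[of "insert M B"]) auto
  also have "\<dots> = Suc (card B)"
    using independent_finite[OF B(2)] notin cmat.span_base[of M B] by (subst card_insert_disjoint) auto
  finally show ?thesis by (simp add: B(4))
qed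

lemma line_eq: "cmat.span {M} = range (\<lambda>c. cscale c M)"
  by (rule cmat.span_singleton)

lemma line_eqI:
  assumes "p \<in> proj_space" "M \<in> p" "M \<noteq> 0"
  shows "p = cmat.span {M}"
proof -
  obtain N where N: "p = cmat.span {N}" using assms(1) by (auto simp: proj_space_def)
  then obtain c where c: "M = cscale c N" using assms(2) by (auto simp: line_eq)
  with assms(3) have "c \<noteq> 0" by auto
  have "cscale d N = cscale (d / c) M" "cscale d M = cscale (d * c) N" for d
    using \<open>c \<noteq> 0\<close> by (simp_all add: c)
  then show ?thesis unfolding N line_eq by blast
qed

lemma line_sym:
  assumes "p \<in> proj_space" "M \<in> p" shows "M \<in> sym_mats"
  using assms by (auto simp: proj_space_def line_eq sym_mats_def transpose_def vec_eq_iff)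

lemma cone_cscale:
  assumes "X \<subseteq> proj_space" "M \<in> affine_cone X" shows "cscale c M \<in> affine_cone X"
proof (cases "M = 0")
  case False
  then obtain p where p: "p \<in> X" "M \<in> p" using assms(2) by (auto simp: affine_cone_def)
  then have "cscale c M \<in> p"
    using assms(1) by (auto simp: proj_space_def intro: cmat.span_scale)
  with p show ?thesis by (auto simp: affine_cone_def)
qed (simp add: affine_cone_def)

lemma line_in_X:
  assumes "X \<subseteq> proj_space" "M \<in> affine_cone X" "M \<noteq> 0" shows "cmat.span {M} \<in> X"
  using assms line_eqI by (auto simp: affine_cone_def)

text \<open>If \<open>f g = 0\<close> on the cone, then on each of its lines the expansions of \<open>f\<close> and \<open>g\<close> in the scaling
  parameter have product zero, so one of them is zero. Thus the lines on which all homogeneous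
  components of \<open>f\<close> vanish, and those for \<open>g\<close>, are two closed subsets of projective space that cover
  \<open>X\<close>.\<close>
lemma affine_cone_irreducible:
  assumes X: "X \<subseteq> proj_space" and irr: "proj_irreducible X"
  shows "irreducible_set (affine_cone X)"
  unfolding irreducible_set_def
proof (intro ballI impI)
  fix f g :: "complex^'a^'a \<Rightarrow> complex"
  assume fg: "f \<in> poly_fun" "g \<in> poly_fun" and zero: "\<forall>M\<in>affine_cone X. f M * g M = 0"
  obtain P d where P: "\<And>M t. f (cscale t M) = poly (P M) t"
    "\<And>k. (\<lambda>M. coeff (P M) k) \<in> hom_poly_fun k" "\<And>M. degree (P M) \<le> d"
    by (rule homogeneous_expansion[OF fg(1)]) blast
  obtain Q e where Q: "\<And>M t. g (cscale t M) = poly (Q M) t"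
    "\<And>k. (\<lambda>M. coeff (Q M) k) \<in> hom_poly_fun k" "\<And>M. degree (Q M) \<le> e"
    by (rule homogeneous_expansion[OF fg(2)]) blast
  let ?Z = "\<lambda>R :: complex^'a^'a \<Rightarrow> complex poly. {p \<in> proj_space. \<forall>f\<in>range (\<lambda>k M. coeff (R M) k). \<forall>M\<in>p - {0}. f M = 0}"
  have vanish: "\<forall>M\<in>affine_cone X. h M = 0"
    if sub: "X \<subseteq> ?Z R"
      and R: "\<And>M t. h (cscale t M) = poly (R M) t" for h and R :: "complex^'a^'a \<Rightarrow> complex poly"
  proof -
    have nz: "h (cscale t M) = 0" if "M \<in> p" "M \<noteq> 0" "p \<in> X" for M p t
    proof -
      have "R M = 0" using sub that by (auto simp: poly_eq_iff)
      then show ?thesis by (simp add: R)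
    qed
    have "h M = 0" if "M \<in> p" "M \<noteq> 0" "p \<in> X" for M p using nz[OF that, of 1] by simp
    moreover have "h 0 = 0"
    proof -
      obtain p where p: "p \<in> X" using irr by (auto simp: proj_irreducible_def)
      then obtain M where "M \<in> p" "M \<noteq> 0" using X by (auto simp: proj_space_def intro: cmat.span_base)
      from nz[OF this p, of 0] show ?thesis by simp
    qed
    ultimately show ?thesis by (auto simp: affine_cone_def)
  qed
  have closed: "proj_closed (?Z R)"
    if "\<And>k. (\<lambda>M. coeff (R M) k) \<in> hom_poly_fun k" for R :: "complex^'a^'a \<Rightarrow> complex poly"
    unfolding proj_closed_def by (rule exI[of _ "range (\<lambda>k M. coeff (R M) k)"]) (use that in auto)
  have cover: "X \<subseteq> ?Z P \<union> ?Z Q"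
  proof
    fix p assume p: "p \<in> X"
    then obtain M where M: "M \<in> p" "M \<noteq> 0" "p = cmat.span {M}"
      using X by (auto simp: proj_space_def intro: cmat.span_base)
    have "poly (P M * Q M) t = 0" for t
    proof -
      have "M \<in> affine_cone X" using p M(1) by (auto simp: affine_cone_def)
      then have "cscale t M \<in> affine_cone X" by (rule cone_cscale[OF X])
      with zero show ?thesis by (simp add: P(1)[symmetric] Q(1)[symmetric])
    qed
    then have "P M * Q M = 0" using poly_all_0_iff_0 by blast
    then have PQ: "P M = 0 \<or> Q M = 0" by simp
    have inZ: "p \<in> ?Z R"
      if "R M = 0" "\<And>k. (\<lambda>M. coeff (R M) k) \<in> hom_poly_fun k" for R :: "complex^'a^'a \<Rightarrow> complex poly"
      using hom_poly_fun_D(2)[OF that(2)] that(1) p X by (auto simp: M(3) line_eq)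
    from PQ show "p \<in> ?Z P \<union> ?Z Q"
    proof
      assume "P M = 0"
      from inZ[OF this P(2)] show ?thesis by (rule UnI1)
    next
      assume "Q M = 0"
      from inZ[OF this Q(2)] show ?thesis by (rule UnI2)
    qed
  qed
  have "X \<subseteq> ?Z P \<or> X \<subseteq> ?Z Q"
    by (rule irr[unfolded proj_irreducible_def, THEN conjunct2, rule_format, of "?Z P" "?Z Q"])
       (intro conjI closed P(2) Q(2) cover)
  then show "(\<forall>M\<in>affine_cone X. f M = 0) \<or> (\<forall>M\<in>affine_cone X. g M = 0)"
  proof
    assume "X \<subseteq> ?Z P"
    from vanish[OF this P(1)] show ?thesis ..
  next
    assume "X \<subseteq> ?Z Q"
    from vanish[OF this Q(1)] show ?thesis ..
  qed
qed

section \<open>Tangent spaces of the cone and of its charts\<close>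

lemma self_in_tangent_cone:
  assumes X: "X \<subseteq> proj_space" and M: "M \<in> affine_cone X"
  shows "M \<in> tangent_space (affine_cone X) M"
proof -
  have "dir_deriv f M M = 0" if "f \<in> vanishing_ideal (affine_cone X)" for f
    using that cone_cscale[OF X M]
    by (intro dir_deriv_eqI) (simp add: cscale_one_plus vanishing_ideal_def)
  then show ?thesis by (simp add: tangent_space_def)
qed

lemma tangent_cone_cscale_subset:
  assumes X: "X \<subseteq> proj_space" and c: "c \<noteq> 0"
  shows "tangent_space (affine_cone X) M \<subseteq> tangent_space (affine_cone X) (cscale c M)"
proof
  fix v assume v: "v \<in> tangent_space (affine_cone X) M"
  have "dir_deriv f (cscale c M) v = 0" if f: "f \<in> vanishing_ideal (affine_cone X)" for f
  proof -
    have "(\<lambda>M. f (cscale c M)) \<in> vanishing_ideal (affine_cone X)"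
      using f cone_cscale[OF X] by (auto simp: vanishing_ideal_def intro: poly_fun_comp_cscale)
    then have "c * dir_deriv f (cscale c M) v = 0"
      using v f dir_deriv_cscale[of f c M v] by (simp add: tangent_space_def vanishing_ideal_def)
    with c show ?thesis by simp
  qed
  then show "v \<in> tangent_space (affine_cone X) (cscale c M)" by (simp add: tangent_space_def)
qed

lemma tangent_cone_cscale:
  assumes X: "X \<subseteq> proj_space" and c: "c \<noteq> 0"
  shows "tangent_space (affine_cone X) (cscale c M) = tangent_space (affine_cone X) M"
  using tangent_cone_cscale_subset[OF assms, of M]
    tangent_cone_cscale_subset[OF X, of "1 / c" "cscale c M"] c by auto

lemma smooth_at_cone_cscale:
  assumes X: "X \<subseteq> proj_space" and c: "c \<noteq> 0"
  shows "smooth_at (affine_cone X) (cscale c M) \<longleftrightarrow> smooth_at (affine_cone X) M"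
  using cone_cscale[OF X, of M c] cone_cscale[OF X, of "cscale c M" "1 / c"] c
  by (auto simp: smooth_at_def tangent_cone_cscale[OF assms])

lemma cone_to_chart:
  assumes "X \<subseteq> proj_space" "M \<in> affine_cone X" "M $ i $ j \<noteq> 0"
  shows "cscale (1 / M $ i $ j) M \<in> chart X i j"
  using cone_cscale[OF assms(1,2)] assms(3) by (simp add: chart_def)

text \<open>Any \<open>f\<close> that vanishes on the chart agrees there with a homogeneous \<open>F\<close>. The function \<open>x F\<close>, where \<open>x\<close>
  is the \<open>(i, j)\<close> entry, vanishes on the whole cone; the factor \<open>x\<close> takes care of the part at infinity.
  Where \<open>x = 1\<close>, its derivative in a direction with \<open>dx = 0\<close> is that of \<open>f\<close>.\<close>
lemma tangent_chart:
  assumes X: "X \<subseteq> proj_space" and M: "M \<in> chart X i j"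
  shows "tangent_space (chart X i j) M = {v \<in> tangent_space (affine_cone X) M. v $ i $ j = 0}"
proof (intro equalityI subsetI)
  fix v assume v: "v \<in> tangent_space (chart X i j) M"
  have "(\<lambda>M. M $ i $ j - 1) \<in> vanishing_ideal (chart X i j)"
    by (auto simp: vanishing_ideal_def chart_def intro!: poly_fun_diff poly_fun.intros)
  then have "dir_deriv (\<lambda>M. M $ i $ j - 1) M v = 0" using v by (simp add: tangent_space_def)
  moreover have "dir_deriv (\<lambda>M. M $ i $ j - 1) M v = v $ i $ j"
    by (rule dir_deriv_eqI) (auto intro!: derivative_eq_intros)
  ultimately show "v \<in> {v \<in> tangent_space (affine_cone X) M. v $ i $ j = 0}"
    using v by (auto simp: tangent_space_def vanishing_ideal_def chart_def)
next
  fix v assume v: "v \<in> {v \<in> tangent_space (affine_cone X) M. v $ i $ j = 0}"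
  have "dir_deriv f M v = 0" if f: "f \<in> vanishing_ideal (chart X i j)" for f
  proof -
    have fp: "f \<in> poly_fun" using f by (simp add: vanishing_ideal_def)
    obtain d F where F: "F \<in> hom_poly_fun d" "\<And>M. M $ i $ j = 1 \<Longrightarrow> F M = f M"
      by (rule homogenization[OF fp, of i j]) blast
    have Fp: "F \<in> poly_fun" by (rule hom_poly_fun_D[OF F(1)])
    have "N $ i $ j * F N = 0" if "N \<in> affine_cone X" for N
    proof (cases "N $ i $ j = 0")
      case False
      have "N = cscale (N $ i $ j) (cscale (1 / N $ i $ j) N)" using False by simp
      then have "F N = (N $ i $ j) ^ d * F (cscale (1 / N $ i $ j) N)"
        using hom_poly_fun_D(2)[OF F(1)] by metis
      also have "F (cscale (1 / N $ i $ j) N) = 0"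
        using F(2) f cone_to_chart[OF X that False] by (simp add: vanishing_ideal_def chart_def)
      finally show ?thesis by simp
    qed simp
    then have "(\<lambda>N. N $ i $ j * F N) \<in> vanishing_ideal (affine_cone X)"
      using Fp by (auto simp: vanishing_ideal_def intro!: poly_fun.intros)
    then have "dir_deriv (\<lambda>N. N $ i $ j * F N) M v = 0" using v by (simp add: tangent_space_def)
    moreover have "dir_deriv (\<lambda>N. N $ i $ j) M v = 0"
      using v by (intro dir_deriv_eqI) (auto intro!: derivative_eq_intros)
    ultimately have "dir_deriv F M v = 0"
      using M by (simp add: dir_deriv_mult[OF poly_fun.entry Fp] chart_def)
    moreover have "dir_deriv F M v = dir_deriv f M v"
      using F(2) v M by (simp add: dir_deriv_def chart_def)
    ultimately show ?thesis by simp
  qed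
  then show "v \<in> tangent_space (chart X i j) M" by (simp add: tangent_space_def)
qed

lemma dim_tangent_cone:
  assumes X: "X \<subseteq> proj_space" and M: "M \<in> chart X i j"
  shows "cmat.dim (tangent_space (affine_cone X) M) = Suc (cmat.dim (tangent_space (chart X i j) M))"
  unfolding tangent_chart[OF assms]
  using M by (intro dim_eq_Suc_dim_hyperplane[OF subspace_tangent_space self_in_tangent_cone[OF X]])
    (auto simp: chart_def)

section \<open>The dimension of the cone\<close>

lemma power_fun_apply: "(f ^ k) x = f x ^ k" for f :: "'a \<Rightarrow> complex"
  by (induction k) auto

lemma prod_fun_apply: "(\<Prod>i\<in>I. f i) x = (\<Prod>i\<in>I. f i x)" for f :: "'i \<Rightarrow> 'a \<Rightarrow> complex"
  by (induction I rule: infinite_finite_induct) auto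

lemma monomial_apply: "monomial k z b x = (\<Prod>i<k. z i x ^ b i)"
  by (simp add: monomial_def prod_fun_apply power_fun_apply)

lemma poly_module_scale: "f \<in> poly_module e z U \<Longrightarrow> fscale c f \<in> poly_module e z U"
  by (metis UN_E UN_I UNIV_I poly_module_def fvs.subspace_scale[OF bounded_module_subspace])

lemma monomial_in_poly_module:
  assumes "\<And>i. i \<ge> e \<Longrightarrow> b i = 0"
  shows "monomial e z b \<in> poly_module e z {1}"
proof -
  have "b \<in> exponents e (\<Sum>i<e. b i)" using assms by (auto simp: exponents_def intro: member_le_sum)
  from bounded_module_base[OF this, of 1 "{1}" z] show ?thesis by (intro poly_module_I) simp
qed

text \<open>Independence applied to exponents of which the \<open>k\<close>-th entry carries other information but is
  determined by the remaining entries.\<close>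
lemma alg_indep_on_family:
  assumes ind: "alg_indep_on V k f" and fin: "finite E"
    and E: "E \<subseteq> {e. \<forall>i\<ge>Suc k. e i = 0}" and inj: "inj_on (\<lambda>e. e(k := 0)) E"
    and zero: "\<And>M. M \<in> V \<Longrightarrow> (\<Sum>e\<in>E. c e * (\<Prod>i<k. f i M ^ e i)) = 0"
    and e: "e \<in> E"
  shows "c e = 0"
proof -
  let ?r = "\<lambda>e :: nat \<Rightarrow> nat. e(k := 0)"
  define c' where "c' = c \<circ> inv_into E ?r"
  have c': "c' (?r e) = c e" if "e \<in> E" for e
    using inv_into_f_f[OF inj that] by (simp add: c'_def)
  have "?r e i = 0" if "e \<in> E" "i \<ge> k" for e i
    using E that by (cases "i = k") auto
  then have sub: "?r ` E \<subseteq> {e. \<forall>i\<ge>k. e i = 0}" by (intro image_subsetI CollectI allI impI)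
  have "(\<Sum>e\<in>?r ` E. c' e * (\<Prod>i<k. f i M ^ e i)) = 0" if "M \<in> V" for M
  proof -
    have "(\<Sum>e\<in>?r ` E. c' e * (\<Prod>i<k. f i M ^ e i)) = (\<Sum>e\<in>E. c' (?r e) * (\<Prod>i<k. f i M ^ ?r e i))"
      by (simp add: sum.reindex[OF inj])
    also have "\<dots> = (\<Sum>e\<in>E. c e * (\<Prod>i<k. f i M ^ e i))"
      by (intro sum.cong refl) (simp add: c')
    finally show ?thesis using zero[OF that] by simp
  qed
  then have "\<forall>e\<in>?r ` E. c' e = 0"
    by (intro ind[unfolded alg_indep_on_def, THEN spec, THEN spec, THEN mp, of "?r ` E" c']
        conjI finite_imageI fin sub ballI)
  then show ?thesis using c'[OF e] e by auto
qed

text \<open>On the multiple \<open>t N\<close> of a point \<open>N\<close> of the chart, a monomial in the \<open>F l\<close> and \<open>x\<close> equals a power of \<open>t\<close>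
  times a monomial in the \<open>f l\<close>. Hence a relation splits according to the power \<open>w\<close> of \<open>t\<close>; among the
  terms with the same \<open>w\<close>, the exponent of \<open>x\<close> is determined by the other exponents.\<close>
lemma alg_indep_homogenize:
  assumes X: "X \<subseteq> proj_space" and ind: "alg_indep_on (chart X i j) k f"
    and F: "\<And>l. l < k \<Longrightarrow> F l \<in> hom_poly_fun (d l)"
    and Ff: "\<And>l M. l < k \<Longrightarrow> M $ i $ j = 1 \<Longrightarrow> F l M = f l M"
  shows "alg_indep_on (affine_cone X) (Suc k) (\<lambda>l. if l < k then F l else (\<lambda>M. M $ i $ j))"
  unfolding alg_indep_on_def
proof (intro allI impI ballI)
  let ?g = "\<lambda>l. if l < k then F l else (\<lambda>M. M $ i $ j)"
  fix E c e0
  assume asm: "finite E \<and> E \<subseteq> {e. \<forall>i\<ge>Suc k. e i = 0} \<and>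
      (\<forall>M\<in>affine_cone X. (\<Sum>e\<in>E. c e * (\<Prod>l<Suc k. ?g l M ^ e l)) = 0)"
    and e0: "e0 \<in> E"
  define w where "w e = (\<Sum>l<k. d l * e l) + e k" for e
  define E' where "E' = {e\<in>E. w e = w e0}"
  have "(\<Sum>e\<in>E'. c e * (\<Prod>l<k. f l N ^ e l)) = 0" if N: "N \<in> chart X i j" for N
  proof -
    define q where "q = (\<Sum>e\<in>E. monom (c e * (\<Prod>l<k. f l N ^ e l)) (w e))"
    have "poly q t = 0" for t
    proof -
      have tN: "cscale t N \<in> affine_cone X" using N by (intro cone_cscale[OF X]) (simp add: chart_def)
      have "poly q t = (\<Sum>e\<in>E. c e * (\<Prod>l<k. f l N ^ e l) * t ^ w e)"
        by (simp add: q_def poly_sum poly_monom)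
      also have "\<dots> = (\<Sum>e\<in>E. c e * (\<Prod>l<Suc k. ?g l (cscale t N) ^ e l))"
      proof (intro sum.cong refl)
        fix e
        have "(\<Prod>l<k. F l (cscale t N) ^ e l) = (\<Prod>l<k. f l N ^ e l * t ^ (d l * e l))"
          using N by (intro prod.cong refl)
            (simp add: hom_poly_fun_D(2)[OF F] Ff chart_def power_mult_distrib power_mult mult.commute)
        also have "\<dots> = (\<Prod>l<k. f l N ^ e l) * t ^ (\<Sum>l<k. d l * e l)"
          by (simp add: prod.distrib power_sum)
        finally have "(\<Prod>l<k. F l (cscale t N) ^ e l) = (\<Prod>l<k. f l N ^ e l) * t ^ (\<Sum>l<k. d l * e l)" .
        moreover have "N $ i $ j = 1" using N by (simp add: chart_def)
        ultimately show "c e * (\<Prod>l<k. f l N ^ e l) * t ^ w e = c e * (\<Prod>l<Suc k. ?g l (cscale t N) ^ e l)"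
          by (simp add: w_def power_add)
      qed
      also have "\<dots> = 0" using asm tN by blast
      finally show ?thesis .
    qed
    then have "q = 0" using poly_all_0_iff_0 by blast
    then have "coeff q (w e0) = 0" by simp
    also have "coeff q (w e0) = (\<Sum>e\<in>E. if w e = w e0 then c e * (\<Prod>l<k. f l N ^ e l) else 0)"
      by (simp add: q_def coeff_sum coeff_monom)
    also have "\<dots> = (\<Sum>e\<in>E'. c e * (\<Prod>l<k. f l N ^ e l))"
      using asm by (simp add: E'_def sum.inter_filter)
    finally show ?thesis .
  qed
  moreover have "inj_on (\<lambda>e. e(k := 0)) E'"
  proof (rule inj_onI)
    fix e e' assume ee: "e \<in> E'" "e' \<in> E'" "e(k := 0) = e'(k := 0)"
    then have eq: "e l = e' l" if "l \<noteq> k" for l using that by (metis fun_upd_other)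
    have "(\<Sum>l<k. d l * e l) = (\<Sum>l<k. d l * e' l)" by (intro sum.cong refl) (auto simp: eq)
    with ee have "e k = e' k" by (simp add: E'_def w_def)
    with eq show "e = e'" by (metis ext)
  qed
  ultimately show "c e0 = 0"
    using asm e0 by (intro alg_indep_on_family[OF ind, of E' c e0]) (auto simp: E'_def)
qed

text \<open>A relation between the \<open>f l\<close> and a coordinate on the chart is homogenized by powers of \<open>x\<close> to a
  relation on the cone. Its leading coefficient is nonzero since it restricts on the chart to a
  nontrivial polynomial in the independent \<open>f l\<close>. The retraction \<open>r\<close> onto the cone turns identities on
  the cone into identities of functions.\<close>
lemma algebraic_over_homogenized:
  assumes X: "X \<subseteq> proj_space" and ind: "alg_indep_on (chart X i j) k f"
    and F: "\<And>l. l < k \<Longrightarrow> F l \<in> hom_poly_fun (d l)"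
    and Ff: "\<And>l M. l < k \<Longrightarrow> M $ i $ j = 1 \<Longrightarrow> F l M = f l M"
    and dep: "\<not> alg_indep_on (chart X i j) (Suc k) (\<lambda>l. if l < k then f l else (\<lambda>M. M $ a $ b))"
    and r: "\<And>M. M \<in> affine_cone X \<Longrightarrow> r M = M" "\<And>M. r M \<in> affine_cone X"
  defines "z \<equiv> \<lambda>l. (if l < k then F l else (\<lambda>M. M $ i $ j)) \<circ> r"
  shows "\<exists>D q. (\<forall>l\<le>D. q l \<in> poly_module (Suc k) z {1}) \<and> q D \<noteq> 0 \<and>
           (\<Sum>l\<le>D. q l * ((\<lambda>M. M $ a $ b) \<circ> r) ^ l) = 0"
proof -
  let ?h = "\<lambda>l. if l < k then f l else (\<lambda>M. M $ a $ b)"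
  obtain E c e0 where E: "finite E" "E \<subseteq> {e. \<forall>i\<ge>Suc k. e i = 0}"
    "\<And>M. M \<in> chart X i j \<Longrightarrow> (\<Sum>e\<in>E. c e * (\<Prod>l<Suc k. ?h l M ^ e l)) = 0"
    "e0 \<in> E" "c e0 \<noteq> 0"
    using dep unfolding alg_indep_on_def by blast
  define E' where "E' = {e\<in>E. c e \<noteq> 0}"
  have finE': "finite E'" "E' \<noteq> {}" using E by (auto simp: E'_def)
  have relE': "(\<Sum>e\<in>E'. c e * (\<Prod>l<Suc k. ?h l M ^ e l)) = 0" if "M \<in> chart X i j" for M
  proof -
    have "(\<Sum>e\<in>E'. c e * (\<Prod>l<Suc k. ?h l M ^ e l)) = (\<Sum>e\<in>E. c e * (\<Prod>l<Suc k. ?h l M ^ e l))"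
      using E(1) by (intro sum.mono_neutral_left) (auto simp: E'_def)
    then show ?thesis using E(3)[OF that] by simp
  qed
  define w where "w e = (\<Sum>l<k. d l * e l) + e k" for e
  \<comment> \<open>A strict upper bound for the weights: every term of the homogenized relation keeps a positive
    power of \<open>x\<close>, so that the relation also holds where \<open>x = 0\<close>.\<close>
  define T where "T = Suc (\<Sum>e\<in>E'. w e)"
  have wT: "w e < T" if "e \<in> E'" for e
    using member_le_sum[OF that, of w] finE' by (simp add: T_def less_Suc_eq_le)
  define D where "D = Max ((\<lambda>e. e k) ` E')"
  have D: "e k \<le> D" if "e \<in> E'" for e using finE' that by (simp add: D_def)
  have "D \<in> (\<lambda>e. e k) ` E'" unfolding D_def using finE' by (intro Max_in) auto
  then obtain e1 where e1: "e1 \<in> E'" "e1 k = D" by auto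
  define q where "q l = (\<Sum>e\<in>{e\<in>E'. e k = l}. fscale (c e) (monomial (Suc k) z (e(k := T - w e))))" for l
  have q_apply: "q l M = (\<Sum>e\<in>{e\<in>E'. e k = l}. c e * ((\<Prod>l<k. F l (r M) ^ e l) * (r M $ i $ j) ^ (T - w e)))"
    for l M
    by (simp add: q_def sum_apply fscale_def monomial_apply z_def)
  show ?thesis
  proof (intro exI[of _ D] exI[of _ q] conjI allI impI)
    show "q l \<in> poly_module (Suc k) z {1}" for l
      unfolding q_def using E(2)
      by (intro poly_module_sum poly_module_scale monomial_in_poly_module) (auto simp: E'_def)
    show "q D \<noteq> 0"
    proof
      assume "q D = 0"
      have "(\<Sum>e\<in>{e\<in>E'. e k = D}. c e * (\<Prod>l<k. f l M ^ e l)) = 0" if M: "M \<in> chart X i j" for M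
      proof -
        have "r M = M" "M $ i $ j = 1" using r(1) M by (auto simp: chart_def)
        then have "(\<Sum>e\<in>{e\<in>E'. e k = D}. c e * (\<Prod>l<k. f l M ^ e l)) = q D M"
          unfolding q_apply by (intro sum.cong refl arg_cong2[of _ _ _ _ "(*)"]) (auto simp: Ff)
        then show ?thesis by (simp add: \<open>q D = 0\<close>)
      qed
      moreover have "inj_on (\<lambda>e. e(k := 0)) {e\<in>E'. e k = D}"
        by (rule inj_onI) (metis (mono_tags, lifting) mem_Collect_eq fun_upd_triv fun_upd_upd)
      ultimately have "c e1 = 0"
        using E finE' e1 by (intro alg_indep_on_family[OF ind, of "{e\<in>E'. e k = D}" c e1]) (auto simp: E'_def)
      with e1 show False by (simp add: E'_def)
    qed
    show "(\<Sum>l\<le>D. q l * ((\<lambda>M. M $ a $ b) \<circ> r) ^ l) = 0"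
    proof
      fix M0
      define M where "M = r M0"
      have M: "M \<in> affine_cone X" by (simp add: M_def r)
      let ?t = "\<lambda>e. c e * ((\<Prod>l<k. F l M ^ e l) * (M $ i $ j) ^ (T - w e)) * (M $ a $ b) ^ e k"
      have "(\<Sum>l\<le>D. q l * ((\<lambda>M. M $ a $ b) \<circ> r) ^ l) M0 = (\<Sum>l\<le>D. \<Sum>e\<in>{e\<in>E'. e k = l}. ?t e)"
        by (simp add: sum_apply q_apply power_fun_apply sum_distrib_right M_def)
      also have "\<dots> = (\<Sum>e\<in>E'. ?t e)"
        using D finE' by (intro sum.group) auto
      also have "\<dots> = 0"
      proof (cases "M $ i $ j = 0")
        case True
        then show ?thesis using wT by (intro sum.neutral) (auto simp: zero_power)
      next
        case False
        define x where "x = M $ i $ j"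
        define N where "N = cscale (1 / x) M"
        have N: "N \<in> chart X i j" "M = cscale x N" "N $ i $ j = 1"
          using cone_to_chart[OF X M False] False by (auto simp: N_def x_def)
        have "?t e = x ^ T * (c e * (\<Prod>l<Suc k. ?h l N ^ e l))" if e: "e \<in> E'" for e
        proof -
          have "(\<Prod>l<k. F l M ^ e l) = (\<Prod>l<k. f l N ^ e l * x ^ (d l * e l))"
            using N(3) unfolding N(2) by (intro prod.cong refl)
              (simp add: hom_poly_fun_D(2)[OF F] Ff power_mult_distrib power_mult mult.commute)
          also have "\<dots> = (\<Prod>l<k. f l N ^ e l) * x ^ (\<Sum>l<k. d l * e l)"
            by (simp add: prod.distrib power_sum)
          finally have 1: "(\<Prod>l<k. F l M ^ e l) = (\<Prod>l<k. f l N ^ e l) * x ^ (\<Sum>l<k. d l * e l)" .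
          have 2: "(M $ a $ b) ^ e k = x ^ e k * (N $ a $ b) ^ e k"
            unfolding N(2) by (simp add: power_mult_distrib)
          have "x ^ T = x ^ (T - w e) * x ^ (\<Sum>l<k. d l * e l) * x ^ e k"
            using wT[OF e] by (simp add: power_add[symmetric] w_def)
          then show ?thesis unfolding 1 2 x_def[symmetric] by simp
        qed
        then have "(\<Sum>e\<in>E'. ?t e) = x ^ T * (\<Sum>e\<in>E'. c e * (\<Prod>l<Suc k. ?h l N ^ e l))"
          unfolding sum_distrib_left by (intro sum.cong refl) blast
        then show ?thesis using relE'[OF N(1)] by simp
      qed
      finally show "(\<Sum>l\<le>D. q l * ((\<lambda>M. M $ a $ b) \<circ> r) ^ l) M0 = 0 M0" by simp
    qed
  qed
qed

lemma alg_hull_entries: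
  "alg_hull (range (\<lambda>(a, b). (\<lambda>M. M $ a $ b) \<circ> r)) = (\<lambda>f. f \<circ> r) ` (poly_fun :: (complex^'n^'n \<Rightarrow> complex) set)"
  (is "alg_hull ?Y = ?R")
proof (intro equalityI subsetI)
  fix h assume "h \<in> alg_hull ?Y"
  then show "h \<in> ?R"
  proof induction
    case (const c)
    show ?case by (rule image_eqI[OF _ poly_fun.const[of c]]) auto
  next
    case (gen y)
    then obtain a b where "y = (\<lambda>M. M $ a $ b) \<circ> r" by auto
    then show ?case by (rule image_eqI[OF _ poly_fun.entry])
  next
    case (add f g)
    then obtain p q where "p \<in> poly_fun" "q \<in> poly_fun" "f = p \<circ> r" "g = q \<circ> r" by blast
    then show ?case by (intro image_eqI[OF _ poly_fun.add[of p q]]) auto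
  next
    case (mult f g)
    then obtain p q where "p \<in> poly_fun" "q \<in> poly_fun" "f = p \<circ> r" "g = q \<circ> r" by blast
    then show ?case by (intro image_eqI[OF _ poly_fun.mult[of p q]]) auto
  qed
next
  fix h assume "h \<in> ?R"
  then obtain f where f: "f \<in> poly_fun" "h = f \<circ> r" by blast
  from f(1) have "f \<circ> r \<in> alg_hull ?Y"
  proof induction
    case (const c)
    show ?case using alg_hull.const[of c ?Y] by (simp add: comp_def)
  next
    case (entry a b)
    show ?case by (intro alg_hull.gen image_eqI[of _ _ "(a, b)"]) auto
  next
    case (add f g)
    from alg_hull.add[OF this(3,4)] show ?case by (simp add: comp_def plus_fun_def)
  next
    case (mult f g)
    from alg_hull.mult[OF this(3,4)] show ?case by (simp add: comp_def times_fun_def)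
  qed
  then show "h \<in> alg_hull ?Y" by (simp add: f)
qed

definition indep_sizes :: "(complex^'n^'n) set \<Rightarrow> nat set" where
  "indep_sizes V = {k. \<exists>f. (\<forall>i<k. f i \<in> poly_fun) \<and> alg_indep_on V k f}"

lemma indep_sizesI:
  assumes "\<forall>l<k. f l \<in> poly_fun" "alg_indep_on V k f" shows "k \<in> indep_sizes V"
  unfolding indep_sizes_def by (rule CollectI, rule exI[of _ f], rule conjI) (rule assms)+

lemma homogenization_family:
  assumes "\<forall>l<k. f l \<in> poly_fun"
  shows "\<exists>F d. \<forall>l<k. F l \<in> hom_poly_fun (d l) \<and> (\<forall>M :: complex^'n^'n. M $ i $ j = 1 \<longrightarrow> F l M = f l M)"
proof -
  have "\<exists>F d. F \<in> hom_poly_fun d \<and> (\<forall>M :: complex^'n^'n. M $ i $ j = 1 \<longrightarrow> F M = f l M)" if "l < k" for l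
  proof -
    have "f l \<in> poly_fun" using assms that by simp
    then obtain d F where "F \<in> hom_poly_fun d" "\<And>M. M $ i $ j = 1 \<Longrightarrow> F M = f l M"
      by (rule homogenization[of _ i j]) blast
    then show ?thesis by blast
  qed
  then show ?thesis by metis
qed

lemma Suc_in_indep_sizes_cone:
  assumes X: "X \<subseteq> proj_space" and k: "k \<in> indep_sizes (chart X i j)"
  shows "Suc k \<in> indep_sizes (affine_cone X)"
proof -
  obtain f where f: "\<forall>l<k. f l \<in> poly_fun" "alg_indep_on (chart X i j) k f"
    using k by (auto simp: indep_sizes_def)
  obtain F d where F: "\<forall>l<k. F l \<in> hom_poly_fun (d l) \<and> (\<forall>M. M $ i $ j = 1 \<longrightarrow> F l M = f l M)"
    using homogenization_family[OF f(1)] by blast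
  have indF: "alg_indep_on (affine_cone X) (Suc k) (\<lambda>l. if l < k then F l else (\<lambda>M. M $ i $ j))"
    using F by (intro alg_indep_homogenize[OF X f(2), of F d]) auto
  have "\<forall>l<Suc k. (if l < k then F l else (\<lambda>M. M $ i $ j)) \<in> poly_fun"
    using F hom_poly_fun_D(1) by (auto intro: poly_fun.entry)
  then show ?thesis using indF by (rule indep_sizesI)
qed

text \<open>Since \<open>Suc k\<close> is not the size of an independent family on the chart, adding any coordinate to one of
  size \<open>k\<close> gives a relation. So the cone is algebraic over the \<open>k\<close> homogenizations and \<open>x\<close>, and the
  counting argument applies.\<close>
lemma indep_sizes_cone_le:
  assumes X: "X \<subseteq> proj_space" and irr: "irreducible_set (affine_cone X)"
    and k: "k \<in> indep_sizes (chart X i j)" and Suc_k: "Suc k \<notin> indep_sizes (chart X i j)"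
    and m: "m \<in> indep_sizes (affine_cone X)"
  shows "m \<le> Suc k"
proof (rule ccontr)
  assume "\<not> m \<le> Suc k"
  then have m_ge: "Suc (Suc k) \<le> m" by simp
  obtain g where g: "\<forall>l<m. g l \<in> poly_fun" "alg_indep_on (affine_cone X) m g"
    using m by (auto simp: indep_sizes_def)
  obtain f where f: "\<forall>l<k. f l \<in> poly_fun" "alg_indep_on (chart X i j) k f"
    using k by (auto simp: indep_sizes_def)
  obtain F d where F: "\<forall>l<k. F l \<in> hom_poly_fun (d l) \<and> (\<forall>M. M $ i $ j = 1 \<longrightarrow> F l M = f l M)"
    using homogenization_family[OF f(1)] by blast
  \<comment> \<open>Composing with a retraction onto the cone replaces functions modulo those vanishing on the cone
    by honest functions, so that the counting argument applies.\<close>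
  define r :: "complex^'a^'a \<Rightarrow> complex^'a^'a" where
    "r M = (if M \<in> affine_cone X then M else 0)" for M
  have r: "\<And>M. M \<in> affine_cone X \<Longrightarrow> r M = M" "\<And>M. r M \<in> affine_cone X"
    by (auto simp: r_def affine_cone_def)
  define z where "z l = (if l < k then F l else (\<lambda>M. M $ i $ j)) \<circ> r" for l
  let ?Y = "range (\<lambda>(a, b). (\<lambda>M :: complex^'a^'a. M $ a $ b) \<circ> r)"
  have "\<exists>n c. (\<exists>b\<in>exponents (Suc (Suc k)) n. c b \<noteq> 0) \<and>
     (\<Sum>b\<in>exponents (Suc (Suc k)) n. fscale (c b) (monomial (Suc (Suc k)) (\<lambda>l. g l \<circ> r) b)) = 0"
  proof (rule algebraic_relation_of_algebraic_generators[of ?Y _ z])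
    show "finite ?Y" by simp
    show "p = 0 \<or> q = 0" if pq: "p \<in> alg_hull ?Y" "q \<in> alg_hull ?Y" "p * q = 0" for p q
    proof -
      obtain p' q' where pq': "p' \<in> poly_fun" "q' \<in> poly_fun" "p = p' \<circ> r" "q = q' \<circ> r"
        using pq(1,2) unfolding alg_hull_entries by blast
      have "p' M * q' M = 0" if "M \<in> affine_cone X" for M
        using fun_cong[OF pq(3), of M] that by (simp add: pq' r)
      then have "(\<forall>M\<in>affine_cone X. p' M = 0) \<or> (\<forall>M\<in>affine_cone X. q' M = 0)"
        using irr pq'(1,2) unfolding irreducible_set_def by blast
      then show ?thesis using r(2) by (auto simp: pq' fun_eq_iff)
    qed
    show "z l \<in> alg_hull ?Y" if "l < Suc k" for l
      unfolding alg_hull_entries z_def using F hom_poly_fun_D(1) by (auto intro!: imageI poly_fun.entry)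
    show "g l \<circ> r \<in> alg_hull ?Y" if "l < Suc (Suc k)" for l
      unfolding alg_hull_entries using g(1) m_ge that by (intro imageI) auto
    fix y assume "y \<in> ?Y"
    then obtain a b where y: "y = (\<lambda>M. M $ a $ b) \<circ> r" by auto
    have polys: "\<forall>l<Suc k. (if l < k then f l else (\<lambda>M. M $ a $ b)) \<in> poly_fun"
      using f(1) by (auto intro: poly_fun.entry)
    have "\<not> alg_indep_on (chart X i j) (Suc k) (\<lambda>l. if l < k then f l else (\<lambda>M. M $ a $ b))"
      using Suc_k indep_sizesI[OF polys] by (rule contrapos_nn)
    then show "\<exists>D q. (\<forall>l\<le>D. q l \<in> poly_module (Suc k) z {1}) \<and> q D \<noteq> 0 \<and> (\<Sum>l\<le>D. q l * y ^ l) = 0"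
      unfolding y z_def using F by (intro algebraic_over_homogenized[OF X f(2) _ _ _ r, of F d]) auto
  qed
  then obtain n c b0 where rel: "b0 \<in> exponents (Suc (Suc k)) n" "c b0 \<noteq> 0"
     "(\<Sum>b\<in>exponents (Suc (Suc k)) n. fscale (c b) (monomial (Suc (Suc k)) (\<lambda>l. g l \<circ> r) b)) = 0" by blast
  have "(\<Sum>b\<in>exponents (Suc (Suc k)) n. c b * (\<Prod>l<m. g l M ^ b l)) = 0" if M: "M \<in> affine_cone X" for M
  proof -
    have "(\<Prod>l<m. g l M ^ b l) = (\<Prod>l<Suc (Suc k). g l M ^ b l)" if "b \<in> exponents (Suc (Suc k)) n" for b
      using that m_ge by (intro prod.mono_neutral_right) (auto simp: exponents_def)
    then have "(\<Sum>b\<in>exponents (Suc (Suc k)) n. c b * (\<Prod>l<m. g l M ^ b l))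
        = (\<Sum>b\<in>exponents (Suc (Suc k)) n. fscale (c b) (monomial (Suc (Suc k)) (\<lambda>l. g l \<circ> r) b)) M"
      unfolding sum_apply by (intro sum.cong refl) (simp add: fscale_def monomial_apply r(1)[OF M])
    then show ?thesis by (simp add: rel(3))
  qed
  moreover have "exponents (Suc (Suc k)) n \<subseteq> {e. \<forall>i\<ge>m. e i = 0}" using m_ge by (auto simp: exponents_def)
  ultimately have "\<forall>b\<in>exponents (Suc (Suc k)) n. c b = 0"
    by (intro g(2)[unfolded alg_indep_on_def, THEN spec, THEN spec, THEN mp] conjI finite_exponents ballI)
  with rel(1) have "c b0 = 0" by blast
  with rel(2) show False by simp
qed

lemma SUP_enat_eq_infinity: "infinite A \<Longrightarrow> (SUP k\<in>A. enat k) = \<infinity>"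
  using finite_imageD[of enat A] by (auto simp: Sup_enat_def inj_on_def)

lemma SUP_enat_eq_Max: "finite A \<Longrightarrow> A \<noteq> {} \<Longrightarrow> (SUP k\<in>A. enat k) = enat (Max A)"
  by (intro antisym SUP_least SUP_upper) auto

text \<open>The maximal sizes of independent families on the cone and on the chart differ by one. The possibility that
  these sizes are unbounded is carried along: it passes from the chart to the cone.\<close>
lemma variety_dim_cone:
  assumes X: "X \<subseteq> proj_space" and irr: "irreducible_set (affine_cone X)"
    and M: "M \<in> chart X i j"
  shows "variety_dim (affine_cone X) = eSuc (variety_dim (chart X i j))"
proof -
  let ?A = "indep_sizes (chart X i j)" and ?B = "indep_sizes (affine_cone X)"
  have dims: "variety_dim (chart X i j) = (SUP k\<in>?A. enat k)" "variety_dim (affine_cone X) = (SUP k\<in>?B. enat k)"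
    by (simp_all add: variety_dim_def indep_sizes_def)
  have "0 \<in> ?A"
  proof -
    have "c e = 0" if "finite E" "E \<subseteq> {e :: nat \<Rightarrow> nat. \<forall>i\<ge>0. e i = 0}" "e \<in> E" "sum c E = 0" for E e and c :: "_ \<Rightarrow> complex"
    proof -
      have "x = (\<lambda>_. 0)" if "x \<in> E" for x using \<open>E \<subseteq> _\<close> that by auto
      with that(3) have "E = {e}" by (metis equalityI insertI1 singletonD subsetI)
      with that show ?thesis by simp
    qed
    then have "alg_indep_on (chart X i j) 0 (\<lambda>_ _. 0)"
      using M unfolding alg_indep_on_def by (auto 4 4)
    then show ?thesis by (auto simp: indep_sizes_def)
  qed
  show ?thesis
  proof (cases "finite ?A")
    case True
    then have k: "Max ?A \<in> ?A" "Suc (Max ?A) \<notin> ?A"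
      using \<open>0 \<in> ?A\<close> Max_in[OF True] Max_ge[OF True, of "Suc (Max ?A)"] by (blast, linarith)
    have B: "?B \<subseteq> {..Suc (Max ?A)}" "Suc (Max ?A) \<in> ?B"
      using indep_sizes_cone_le[OF X irr k] Suc_in_indep_sizes_cone[OF X k(1)] by auto
    have "(SUP k\<in>?B. enat k) = enat (Suc (Max ?A))"
      using B by (intro antisym SUP_least SUP_upper) auto
    moreover have "(SUP k\<in>?A. enat k) = enat (Max ?A)"
      using \<open>0 \<in> ?A\<close> True by (intro SUP_enat_eq_Max) auto
    ultimately show ?thesis by (simp add: dims eSuc_enat)
  next
    case False
    have "Suc ` ?A \<subseteq> ?B" using Suc_in_indep_sizes_cone[OF X] by blast
    then have "infinite ?B" using False by (meson finite_imageD finite_subset inj_Suc inj_on_subset top_greatest)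
    with False show ?thesis by (simp add: dims SUP_enat_eq_infinity)
  qed
qed

lemma smooth_at_chart_iff:
  assumes X: "X \<subseteq> proj_space" and irr: "irreducible_set (affine_cone X)"
    and M: "M \<in> chart X i j"
  shows "smooth_at (chart X i j) M \<longleftrightarrow> smooth_at (affine_cone X) M"
  using M variety_dim_cone[OF X irr M] dim_tangent_cone[OF X M]
  by (auto simp: smooth_at_def chart_def eSuc_enat[symmetric])

lemma proj_smooth_at_iff:
  assumes X: "X \<subseteq> proj_space" and irr: "irreducible_set (affine_cone X)"
    and M: "M \<in> affine_cone X" "M \<noteq> 0"
  shows "proj_smooth_at X (cmat.span {M}) \<longleftrightarrow> smooth_at (affine_cone X) M"
proof
  assume "proj_smooth_at X (cmat.span {M})"
  then obtain i j N where N: "N \<in> cmat.span {M}" "N $ i $ j = 1" "smooth_at (chart X i j) N"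
    by (auto simp: proj_smooth_at_def)
  then have "N \<in> chart X i j" by (simp add: smooth_at_def)
  with N have "smooth_at (affine_cone X) N" by (simp add: smooth_at_chart_iff[OF X irr])
  moreover obtain c where "N = cscale c M" using N(1) by (auto simp: line_eq)
  moreover from this N(2) have "c \<noteq> 0" by auto
  ultimately show "smooth_at (affine_cone X) M" by (simp add: smooth_at_cone_cscale[OF X])
next
  assume sm: "smooth_at (affine_cone X) M"
  obtain i j where ij: "M $ i $ j \<noteq> 0" using M(2) by (auto simp: vec_eq_iff)
  let ?N = "cscale (1 / M $ i $ j) M"
  have "?N \<in> chart X i j" by (rule cone_to_chart[OF X M(1) ij])
  moreover have "smooth_at (affine_cone X) ?N"
    using sm ij by (subst smooth_at_cone_cscale[OF X]) auto
  ultimately have "smooth_at (chart X i j) ?N" by (simp add: smooth_at_chart_iff[OF X irr])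
  then show "proj_smooth_at X (cmat.span {M})"
    unfolding proj_smooth_at_def using line_in_X[OF X M] ij
    by (intro conjI exI[of _ i] exI[of _ j] bexI[of _ ?N]) (auto simp: line_eq)
qed

section \<open>Generic symmetric matrices\<close>

lemma sym_mats_line:
  assumes "M \<in> sym_mats" "N \<in> sym_mats" shows "M + cscale t (N - M) \<in> sym_mats"
  using assms by (simp add: sym_mats_def transpose_def vec_eq_iff)

lemma poly_fun_mult_nonzero:
  assumes fg: "f \<in> poly_fun" "g \<in> poly_fun"
    and M: "M \<in> sym_mats" "f M \<noteq> 0" and N: "N \<in> sym_mats" "g N \<noteq> 0"
  shows "\<exists>S\<in>sym_mats. f S * g S \<noteq> 0"
proof -
  obtain p where p: "\<forall>t. f (M + cscale t (N - M)) = poly p t"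
    using poly_fun_on_line[OF fg(1)] by blast
  obtain q where q: "\<forall>t. g (M + cscale t (N - M)) = poly q t"
    using poly_fun_on_line[OF fg(2)] by blast
  have "p \<noteq> 0" using p[rule_format, of 0] M by auto
  moreover have "q \<noteq> 0" using q[rule_format, of 1] N by auto
  ultimately have "p * q \<noteq> 0" by simp
  then obtain t where "poly (p * q) t \<noteq> 0" using poly_all_0_iff_0 by blast
  then show ?thesis using sym_mats_line[OF M(1) N(1), of t] p q
    by (intro bexI[of _ "M + cscale t (N - M)"]) auto
qed

lemma for_generic_mono: "for_generic P \<Longrightarrow> (\<And>S. P S \<Longrightarrow> Q S) \<Longrightarrow> for_generic Q"
  unfolding for_generic_def by meson

text \<open>Two nonempty open sets meet: a nonzero polynomial from each is restricted to the line through two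
  points where they do not vanish, and there the product is a nonzero polynomial.\<close>
lemma for_generic_conj:
  assumes "for_generic P" "for_generic Q"
  shows "for_generic (\<lambda>S. P S \<and> Q S)"
proof -
  obtain A where A: "zariski_closed A" "sym_mats - A \<noteq> {}" "\<forall>S\<in>sym_mats - A. P S"
    using assms(1) unfolding for_generic_def by meson
  obtain B where B: "zariski_closed B" "sym_mats - B \<noteq> {}" "\<forall>S\<in>sym_mats - B. Q S"
    using assms(2) unfolding for_generic_def by meson
  obtain F where F: "F \<subseteq> poly_fun" "A = {M\<in>sym_mats. \<forall>f\<in>F. f M = 0}"
    using A(1) by (auto simp: zariski_closed_def)
  obtain G where G: "G \<subseteq> poly_fun" "B = {M\<in>sym_mats. \<forall>f\<in>G. f M = 0}"
    using B(1) by (auto simp: zariski_closed_def)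
  let ?H = "(\<lambda>(f, g) M. f M * g M) ` (F \<times> G)"
  have "?H \<subseteq> poly_fun" using F G by (auto intro!: poly_fun.mult)
  moreover have "A \<union> B = {M\<in>sym_mats. \<forall>h\<in>?H. h M = 0}"
    unfolding F(2) G(2) by auto
  ultimately have "zariski_closed (A \<union> B)" unfolding zariski_closed_def by meson
  moreover have "sym_mats - (A \<union> B) \<noteq> {}"
  proof -
    obtain f M where f: "f \<in> F" "M \<in> sym_mats" "f M \<noteq> 0" using A(2) F(2) by auto
    obtain g N where g: "g \<in> G" "N \<in> sym_mats" "g N \<noteq> 0" using B(2) G(2) by auto
    have "f \<in> poly_fun" "g \<in> poly_fun" using f(1) g(1) F(1) G(1) by auto
    from poly_fun_mult_nonzero[OF this f(2,3) g(2,3)] obtain S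
      where "S \<in> sym_mats" "f S \<noteq> 0" "g S \<noteq> 0" by auto
    then show ?thesis using f(1) g(1) F(2) G(2) by auto
  qed
  ultimately show ?thesis
    unfolding for_generic_def using A(3) B(3) by (intro exI[of _ "A \<union> B"]) auto
qed

lemma for_generic_True: "for_generic (\<lambda>S. True)"
proof -
  have "zariski_closed {}" unfolding zariski_closed_def
    by (rule exI[of _ "{\<lambda>_. 1}"]) (auto intro: poly_fun.const)
  moreover have "0 \<in> sym_mats" by (simp add: sym_mats_def transpose_def vec_eq_iff)
  ultimately show ?thesis unfolding for_generic_def by (intro exI[of _ "{}"]) auto
qed

lemma for_generic_ball:
  assumes "finite W" "\<And>N. N \<in> W \<Longrightarrow> for_generic (\<lambda>S. P N S)"
  shows "for_generic (\<lambda>S. \<forall>N\<in>W. P N S)"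
  using assms
proof (induction W rule: finite_induct)
  case empty
  then show ?case using for_generic_True by simp
next
  case (insert N W)
  then have "for_generic (\<lambda>S. P N S \<and> (\<forall>N\<in>W. P N S))" by (intro for_generic_conj) auto
  then show ?case by (rule for_generic_mono) auto
qed

text \<open>The witness is the complex conjugate of \<open>N\<close>, for which the trace is the squared norm of \<open>N\<close>.\<close>
lemma for_generic_trace_nonzero:
  assumes N: "N \<in> sym_mats" "N \<noteq> 0"
  shows "for_generic (\<lambda>S. trace (S ** N) \<noteq> 0)"
proof -
  have "(\<lambda>S. trace (S ** N)) \<in> poly_fun"
    unfolding trace_mult_eq by (intro poly_fun_sum poly_fun.mult poly_fun.const poly_fun.entry)
  then have "zariski_closed {S\<in>sym_mats. trace (S ** N) = 0}"
    unfolding zariski_closed_def by (intro exI[of _ "{\<lambda>S. trace (S ** N)}"]) auto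
  moreover have "\<exists>S\<in>sym_mats. trace (S ** N) \<noteq> 0"
  proof
    define S :: "complex^'a^'a" where "S = (\<chi> i j. cnj (N $ i $ j))"
    have sym: "N $ i $ j = N $ j $ i" for i j
      using N(1) by (metis (mono_tags) mem_Collect_eq sym_mats_def transpose_def vec_lambda_beta)
    show "S \<in> sym_mats" by (simp add: S_def sym_mats_def transpose_def vec_eq_iff sym)
    have cnj_sq: "cnj z * z = of_real ((cmod z)\<^sup>2)" for z
      by (metis complex_norm_square mult.commute)
    obtain i0 j0 where ij: "N $ i0 $ j0 \<noteq> 0" using N(2) by (auto simp: vec_eq_iff)
    have "trace (S ** N) = (\<Sum>i\<in>UNIV. \<Sum>j\<in>UNIV. cnj (N $ i $ j) * N $ i $ j)"
      by (simp add: trace_mult_eq S_def sym[symmetric])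
    also have "\<dots> = of_real (\<Sum>i\<in>UNIV. \<Sum>j\<in>UNIV. (cmod (N $ i $ j))\<^sup>2)"
      by (simp only: cnj_sq of_real_sum)
    finally have eq: "trace (S ** N) = of_real (\<Sum>p\<in>UNIV. (cmod (N $ fst p $ snd p))\<^sup>2)"
      by (simp add: sum.cartesian_product split_beta)
    have "(\<Sum>p\<in>UNIV. (cmod (N $ fst p $ snd p))\<^sup>2) > 0"
      using ij by (intro sum_pos2[of _ "(i0, j0)"]) auto
    then show "trace (S ** N) \<noteq> 0" unfolding eq of_real_eq_0_iff by linarith
  qed
  ultimately show ?thesis unfolding for_generic_def
    by (intro exI[of _ "{S\<in>sym_mats. trace (S ** N) = 0}"]) auto
qed

section \<open>Critical points\<close>

abbreviation trace_power :: "complex^'n^'n \<Rightarrow> complex^'n^'n \<Rightarrow> complex" where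
  "trace_power S \<equiv> \<lambda>M. trace (S ** M) ^ CARD('n)"

lemma trace_power_hom: "trace_power (S :: complex^'n^'n) \<in> hom_poly_fun CARD('n)"
  using hom_poly_fun_power[OF hom_poly_fun_trace[of S], of "CARD('n)"] by simp

text \<open>The zero set of \<open>det\<close> on the cone is a finite union of irreducible sets, and \<open>W\<close> contains one nonzero
  matrix from each of them that has one. If \<open>tr (S N) \<noteq> 0\<close> on \<open>W\<close>, then on a piece through a unit point the identity
  \<open>det b = tr (S M) ^ n a\<close> forces \<open>a = 0\<close>. When \<open>det\<close> vanishes on all of \<open>X\<close>, this says that there are no unit
  points.\<close>
lemma det_nonzero_at_units:
  assumes X: "X \<subseteq> (proj_space :: (complex^'n^'n) set set)"
  shows "\<exists>W. finite W \<and> W \<subseteq> sym_mats - {0} \<and>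
    (\<forall>S. (\<forall>N\<in>W. trace (S ** N) \<noteq> 0) \<longrightarrow>
      (\<forall>p\<in>X. \<forall>a b. unit_rep X det (trace_power S) p a b \<longrightarrow> (\<forall>M\<in>p - {0}. det M \<noteq> 0)))"
proof -
  obtain \<Z> where Z: "finite \<Z>" "\<Union>\<Z> = {M\<in>affine_cone X. det M = 0}" "\<forall>Y\<in>\<Z>. irreducible_set Y"
    using finite_irreducible_decomposition by meson
  define N where "N Y = (SOME M. M \<in> Y - {0})" for Y :: "(complex^'n^'n) set"
  have N: "N Y \<in> Y - {0}" if "Y - {0} \<noteq> {}" for Y
    using some_in_eq[of "Y - {0}"] that by (simp add: N_def)
  define W where "W = N ` {Y\<in>\<Z>. Y - {0} \<noteq> {}}"
  have "W \<subseteq> affine_cone X - {0}"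
  proof
    fix K assume "K \<in> W"
    then obtain Y where Y: "Y \<in> \<Z>" "Y - {0} \<noteq> {}" "K = N Y" unfolding W_def by blast
    have "K \<in> Y - {0}" unfolding Y(3) by (rule N[OF Y(2)])
    moreover from this Y(1) have "K \<in> \<Union>\<Z>" by auto
    ultimately show "K \<in> affine_cone X - {0}" unfolding Z(2) by auto
  qed
  moreover have "affine_cone X - {0} \<subseteq> sym_mats - {0}"
    using X line_sym by (auto simp: affine_cone_def)
  ultimately have W_sub: "W \<subseteq> sym_mats - {0}" by (rule order_trans)
  have unit: "det M \<noteq> 0"
    if S: "\<forall>N\<in>W. trace (S ** N) \<noteq> 0" and p: "p \<in> X" "unit_rep X det (trace_power S) p a b"
      "M \<in> p - {0}" for S p a b M
  proof
    assume "det M = 0"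
    then have "M \<in> \<Union>\<Z>" using p unfolding Z(2) by (auto simp: affine_cone_def)
    then obtain Y where Y: "Y \<in> \<Z>" "M \<in> Y" by blast
    have NY: "N Y \<in> Y - {0}" "N Y \<in> W" using N[of Y] Y p(3) by (auto simp: W_def)
    have a: "a \<in> poly_fun" "a M \<noteq> 0" using p hom_poly_fun_D(1) by (auto simp: unit_rep_def)
    have "trace_power S \<in> poly_fun" by (rule hom_poly_fun_D[OF trace_power_hom])
    moreover have "trace_power S K * a K = 0" if "K \<in> Y" for K
    proof -
      have "K \<in> affine_cone X" "det K = 0" using that Y(1) Z(2) by auto
      then show ?thesis using p(2) unfolding unit_rep_def by (metis mult_zero_left)
    qed
    ultimately have "(\<forall>K\<in>Y. trace_power S K = 0) \<or> (\<forall>K\<in>Y. a K = 0)"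
      by (intro irreducible_setD[OF Z(3)[rule_format, OF Y(1)]] a(1))
    then show False
    proof
      assume "\<forall>K\<in>Y. trace_power S K = 0"
      with NY(1) have "trace (S ** N Y) = 0" by auto
      with S NY(2) show False by blast
    next
      assume "\<forall>K\<in>Y. a K = 0"
      with a(2) Y(2) show False by blast
    qed
  qed
  show ?thesis
  proof (intro exI conjI allI impI ballI)
    show "finite W" using Z(1) by (simp add: W_def)
    show "W \<subseteq> sym_mats - {0}" by (rule W_sub)
  qed (rule unit)
qed

lemma unit_rep_self:
  fixes S :: "complex^'n^'n"
  assumes "det M \<noteq> 0" "trace (S ** M) \<noteq> 0"
  shows "unit_rep X det (trace_power S) (cmat.span {M}) det (trace_power S)"
proof -
  have "det N \<noteq> 0 \<and> trace_power S N \<noteq> 0" if N: "N \<in> cmat.span {M} - {0}" for N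
  proof -
    obtain c where "N = cscale c M" using N by (auto simp: line_eq)
    moreover from this N have "c \<noteq> 0" by auto
    ultimately show ?thesis
      using assms hom_poly_fun_D(2)[OF hom_poly_fun_det, of c M]
        hom_poly_fun_D(2)[OF trace_power_hom, of S c M] by simp
  qed
  then show ?thesis
    unfolding unit_rep_def using hom_poly_fun_det trace_power_hom[of S] by (auto simp: mult.commute)
qed

text \<open>The logarithmic derivative may be computed from any representative \<open>a / b\<close>: the function
  \<open>det b - tr (S M) ^ n a\<close> vanishes on the cone, so its derivative is zero on the tangent space.\<close>
lemma dlog_unit_rep:
  fixes S :: "complex^'n^'n"
  assumes rep: "unit_rep X det (trace_power S) p a b"
    and M: "M \<in> p" "p \<in> X" "M \<noteq> 0" "det M \<noteq> 0" "trace (S ** M) \<noteq> 0"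
    and v: "v \<in> tangent_space (affine_cone X) M"
  shows "dir_deriv (\<lambda>N. a N / b N) M v / (a M / b M)
     = dir_deriv det M v / det M - of_nat CARD('n) * trace (S ** v) / trace (S ** M)"
proof -
  let ?h = "trace_power S" and ?n = "CARD('n)"
  have polys: "a \<in> poly_fun" "b \<in> poly_fun" "det \<in> (poly_fun :: (complex^'n^'n \<Rightarrow> complex) set)" "?h \<in> poly_fun"
    using rep hom_poly_fun_D(1) hom_poly_fun_det trace_power_hom[of S] by (auto simp: unit_rep_def)
  have nz: "a M \<noteq> 0" "b M \<noteq> 0" "?h M \<noteq> 0" using rep M by (auto simp: unit_rep_def)
  have eq: "det N * b N = ?h N * a N" if "N \<in> affine_cone X" for N
    using rep that by (auto simp: unit_rep_def)
  have eqM: "det M * b M = ?h M * a M" using M by (intro eq) (auto simp: affine_cone_def)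
  have "(\<lambda>N. det N * b N - ?h N * a N) \<in> vanishing_ideal (affine_cone X)"
    using polys eq by (auto simp: vanishing_ideal_def intro!: poly_fun_diff poly_fun.mult)
  then have "dir_deriv (\<lambda>N. det N * b N - ?h N * a N) M v = 0"
    using v by (simp add: tangent_space_def)
  then have 1: "dir_deriv det M v * b M + dir_deriv b M v * det M
      = dir_deriv ?h M v * a M + dir_deriv a M v * ?h M"
    by (simp add: dir_deriv_diff[OF poly_fun.mult poly_fun.mult] dir_deriv_mult polys)
  have "(dir_deriv det M v * b M + dir_deriv b M v * det M) / (det M * b M)
      = (dir_deriv ?h M v * a M + dir_deriv a M v * ?h M) / (?h M * a M)"
    using 1 eqM by simp
  then have 2: "dir_deriv det M v / det M + dir_deriv b M v / b M
      = dir_deriv ?h M v / ?h M + dir_deriv a M v / a M"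
    using M(4) nz by (simp add: add_divide_distrib)
  have 3: "dir_deriv ?h M v / ?h M = of_nat ?n * trace (S ** v) / trace (S ** M)"
    using M(5) power_minus_mult[of ?n "trace (S ** M)"] by (simp add: dir_deriv_trace_power field_simps)
  have "dir_deriv (\<lambda>N. a N / b N) M v / (a M / b M) = dir_deriv a M v / a M - dir_deriv b M v / b M"
    using nz by (simp add: dir_deriv_divide polys field_simps)
  also have "\<dots> = dir_deriv det M v / det M - dir_deriv ?h M v / ?h M"
    using 2 by algebra
  finally show ?thesis unfolding 3 .
qed

text \<open>Testing the likelihood equation on \<open>v = M\<close> gives the normalization \<open>tr (S M) = n\<close>, after which both
  equations are the same.\<close>
lemma likelihood_critical_iff:
  assumes X: "X \<subseteq> proj_space" and M: "M \<in> affine_cone X" "det M \<noteq> 0"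
  shows "(\<forall>v\<in>tangent_space (affine_cone X) M. dir_deriv det M v / det M - trace (S ** v) = 0) \<longleftrightarrow>
    trace (S ** M) = of_nat CARD('n) \<and>
    (\<forall>v\<in>tangent_space (affine_cone X) M. dir_deriv det M v / det M
        = of_nat CARD('n) * trace (S ** v) / trace (S ** (M :: complex^'n^'n)))" (is "?L \<longleftrightarrow> ?R")
proof
  assume ?L
  then have "trace (S ** M) = of_nat CARD('n)"
    using self_in_tangent_cone[OF X M(1)] dir_deriv_self[OF hom_poly_fun_det, of M] M(2) by auto
  with \<open>?L\<close> show ?R by auto
qed auto

lemma log_derivative_cscale:
  fixes M :: "complex^'n^'n"
  assumes "c \<noteq> 0"
  shows "dir_deriv det (cscale c M) v / det (cscale c M) = (dir_deriv det M v / det M) / c"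
proof -
  have det: "det (cscale c M) = c ^ CARD('n) * det M" for M :: "complex^'n^'n"
    by (rule hom_poly_fun_D(2)[OF hom_poly_fun_det])
  have "c * dir_deriv det (cscale c M) v = dir_deriv (\<lambda>M. det (cscale c M)) M v"
    by (rule dir_deriv_cscale[symmetric, OF hom_poly_fun_D(1)[OF hom_poly_fun_det]])
  also have "\<dots> = c ^ CARD('n) * dir_deriv det M v"
    unfolding det using has_dir_deriv[OF hom_poly_fun_D(1)[OF hom_poly_fun_det], of M v]
    by (intro dir_deriv_eqI DERIV_cmult)
  finally have "dir_deriv det (cscale c M) v = c ^ CARD('n) * dir_deriv det M v / c"
    using assms by (simp add: field_simps)
  with assms show ?thesis by (simp add: det)
qed

text \<open>Both sides say that \<open>\<omega>(v) = d det(v) / det M - n tr (S v) / tr (S M)\<close> is zero. The chart sees \<open>\<omega>\<close> only on the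
  hyperplane \<open>dx = 0\<close> of the tangent space of the cone, at the multiple of \<open>M\<close> with \<open>x = 1\<close>; since
  \<open>\<omega>(M) = 0\<close> and \<open>\<omega>\<close> is homogeneous in the base point, nothing is lost.\<close>
lemma log_critical_iff:
  fixes S :: "complex^'n^'n"
  assumes X: "X \<subseteq> proj_space" and irr: "irreducible_set (affine_cone X)"
    and M: "M \<in> affine_cone X" "det M \<noteq> 0" "trace (S ** M) \<noteq> 0"
  shows "cmat.span {M} \<in> det_trace_critical_points X S \<longleftrightarrow>
    smooth_at (affine_cone X) M \<and> (\<forall>v\<in>tangent_space (affine_cone X) M. dir_deriv det M v / det M
        = of_nat CARD('n) * trace (S ** v) / trace (S ** M))"
proof -
  let ?p = "cmat.span {M}" and ?T = "tangent_space (affine_cone X)"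
  let ?w = "\<lambda>M v. dir_deriv det M v / det M - of_nat CARD('n) * trace (S ** v) / trace (S ** M)"
  have M0: "M \<noteq> 0" using M(3) by (auto simp: trace_mult_eq)
  have pX: "?p \<in> X" by (rule line_in_X[OF X M(1) M0])
  have rep: "unit_rep X det (trace_power S) ?p det (trace_power S)"
    by (rule unit_rep_self[OF M(2,3)])
  have scale: "?w (cscale c M) v = ?w M v / c" if "c \<noteq> 0" for c v
    using that by (simp add: log_derivative_cscale trace_mult_linear diff_divide_distrib)
  have nz: "det (cscale c M) \<noteq> 0" "trace (S ** cscale c M) \<noteq> 0" "cscale c M \<noteq> 0" "cscale c M \<in> ?p"
    if "c \<noteq> 0" for c
    using that M M0 hom_poly_fun_D(2)[OF hom_poly_fun_det, of c M]
    by (auto simp: trace_mult_linear line_eq)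
  have "dlog_vanishes_at X det (trace_power S) ?p \<longleftrightarrow> (\<forall>v\<in>?T M. ?w M v = 0)"
  proof
    assume van: "dlog_vanishes_at X det (trace_power S) ?p"
    obtain i j where ij: "M $ i $ j \<noteq> 0" using M0 by (auto simp: vec_eq_iff)
    define c where "c = 1 / M $ i $ j"
    have c: "c \<noteq> 0" "cscale c M \<in> chart X i j"
      using ij cone_to_chart[OF X M(1) ij] by (auto simp: c_def)
    have w0: "?w (cscale c M) v = 0" if v: "v \<in> ?T M" "v $ i $ j = 0" for v
    proof -
      have v': "v \<in> ?T (cscale c M)" using v tangent_cone_cscale[OF X c(1)] by simp
      then have "v \<in> tangent_space (chart X i j) (cscale c M)"
        using v by (simp add: tangent_chart[OF X c(2)])
      then have "dir_deriv (\<lambda>N. det N / trace_power S N) (cscale c M) v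
          / (det (cscale c M) / trace_power S (cscale c M)) = 0"
        using van rep nz(4)[OF c(1)] c(2) unfolding dlog_vanishes_at_def chart_def by blast
      then show ?thesis
        by (rule trans[OF dlog_unit_rep[OF rep nz(4)[OF c(1)] pX nz(3,1,2)[OF c(1)] v', symmetric]])
    qed
    show "\<forall>v\<in>?T M. ?w M v = 0"
    proof
      fix v assume v: "v \<in> ?T M"
      \<comment> \<open>Every tangent vector is tangent to the chart up to a multiple of \<open>M\<close>, on which the form is zero.\<close>
      define u where "u = v - cscale (v $ i $ j / M $ i $ j) M"
      have u: "u \<in> ?T M"
        unfolding u_def using v self_in_tangent_cone[OF X M(1)] subspace_tangent_space
        by (intro cmat.subspace_diff cmat.subspace_scale) auto
      moreover have "u $ i $ j = 0" using ij by (simp add: u_def)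
      ultimately have "?w (cscale c M) u = 0" by (rule w0)
      then have wu: "?w M u = 0" using scale[OF c(1)] c(1) by simp
      have v_eq: "v = u + cscale (v $ i $ j / M $ i $ j) M" by (simp add: u_def)
      have "?w M M = 0"
        using dir_deriv_self[OF hom_poly_fun_det, of M] M by simp
      moreover have "?w M (u + cscale d M) = ?w M u + d * ?w M M" for d
        by (simp add: dir_deriv_linear[OF hom_poly_fun_D(1)[OF hom_poly_fun_det]] trace_mult_linear
            add_divide_distrib algebra_simps)
      ultimately have "?w M (u + cscale d M) = 0" for d using wu by simp
      from this[of "v $ i $ j / M $ i $ j"] show "?w M v = 0" unfolding v_eq[symmetric] .
    qed
  next
    assume crit: "\<forall>v\<in>?T M. ?w M v = 0"
    show "dlog_vanishes_at X det (trace_power S) ?p"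
      unfolding dlog_vanishes_at_def
    proof (intro allI impI ballI)
      fix a b i j N v
      assume r: "unit_rep X det (trace_power S) ?p a b" and N: "N \<in> ?p" "N $ i $ j = 1"
        and v: "v \<in> tangent_space (chart X i j) N"
      obtain c where c: "N = cscale c M" using N(1) by (auto simp: line_eq)
      with N(2) have c0: "c \<noteq> 0" by auto
      have "N \<in> chart X i j" using cone_cscale[OF X M(1), of c] N(2) by (simp add: chart_def c)
      then have vN: "v \<in> ?T N" using v by (simp add: tangent_chart[OF X])
      then have "v \<in> ?T M" by (simp add: c tangent_cone_cscale[OF X c0])
      then have "?w N v = 0" using crit scale[OF c0, of v] c by simp
      then show "dir_deriv (\<lambda>N. a N / b N) N v / (a N / b N) = 0"
        using dlog_unit_rep[OF r N(1) pX _ _ _ vN] nz[OF c0] c by simp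
    qed
  qed
  moreover have "?p \<notin> supp_div X det (trace_power S)" using rep by (auto simp: supp_div_def)
  ultimately show ?thesis
    using pX proj_smooth_at_iff[OF X irr M(1) M0]
    by (simp add: det_trace_critical_points_def log_critical_points_def)
qed

text \<open>The condition \<open>tr (S M) = n\<close> picks exactly one representative on each line with \<open>tr (S M) \<noteq> 0\<close>. A
  critical line has a unit representative \<open>a / b\<close>, so \<open>det \<noteq> 0\<close> there by hypothesis, and then
  \<open>tr (S M) \<noteq> 0\<close> follows from \<open>det b = tr (S M) ^ n a\<close>.\<close>
lemma critical_points_bij_betw:
  fixes S :: "complex^'n^'n"
  assumes X: "X \<subseteq> proj_space" and irr: "irreducible_set (affine_cone X)"
    and unit: "\<And>p a b M. p \<in> X \<Longrightarrow> unit_rep X det (trace_power S) p a b \<Longrightarrow> M \<in> p - {0} \<Longrightarrow> det M \<noteq> 0"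
  shows "bij_betw (\<lambda>M. cmat.span {M}) (likelihood_critical_points X S) (det_trace_critical_points X S)"
proof -
  let ?L = "likelihood_critical_points X S" and ?n = "of_nat CARD('n) :: complex"
  have L: "M \<in> ?L \<longleftrightarrow> M \<in> affine_cone X \<and> det M \<noteq> 0 \<and> trace (S ** M) = ?n \<and>
      cmat.span {M} \<in> det_trace_critical_points X S" for M
  proof (cases "M \<in> affine_cone X \<and> det M \<noteq> 0")
    case True
    then have M: "M \<in> affine_cone X" "det M \<noteq> 0" by auto
    show ?thesis
    proof (cases "trace (S ** M) = ?n")
      case tr: True
      then have "trace (S ** M) \<noteq> 0" by simp
      from log_critical_iff[OF X irr M this] show ?thesis
        using likelihood_critical_iff[OF X M, of S] M tr
        by (auto simp: likelihood_critical_points_def cone_open_part_def)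
    next
      case False
      then show ?thesis using likelihood_critical_iff[OF X M, of S]
        by (auto simp: likelihood_critical_points_def)
    qed
  next
    case False
    then show ?thesis
      by (auto simp: likelihood_critical_points_def cone_open_part_def smooth_at_def)
  qed
  show ?thesis
    unfolding bij_betw_def
  proof (intro conjI inj_onI equalityI subsetI)
    fix M N assume MN: "M \<in> ?L" "N \<in> ?L" "cmat.span {M} = cmat.span {N}"
    then have "M \<in> cmat.span {N}" using cmat.span_base[of M "{M}"] by simp
    then obtain c where c: "M = cscale c N" by (auto simp: line_eq)
    have "?n = c * ?n" using MN(1,2) trace_mult_linear(2)[of S c N] unfolding L c by simp
    then show "M = N" using c by simp
  next
    fix p assume "p \<in> (\<lambda>M. cmat.span {M}) ` ?L"
    then show "p \<in> det_trace_critical_points X S" using L by auto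
  next
    fix p assume p: "p \<in> det_trace_critical_points X S"
    then have pX: "p \<in> X" "p \<notin> supp_div X det (trace_power S)"
      by (auto simp: det_trace_critical_points_def log_critical_points_def)
    then obtain a b where rep: "unit_rep X det (trace_power S) p a b" by (auto simp: supp_div_def)
    have "p \<in> proj_space" using pX X by blast
    then obtain N where N: "p = cmat.span {N}" "N \<noteq> 0" by (auto simp: proj_space_def)
    then have Np: "N \<in> p" by (auto intro: cmat.span_base)
    then have NX: "N \<in> affine_cone X" using pX by (auto simp: affine_cone_def)
    have det: "det N \<noteq> 0" using unit[OF pX(1) rep] Np N(2) by blast
    have "det N * b N = trace_power S N * a N" "b N \<noteq> 0"
      using rep NX Np N(2) by (auto simp: unit_rep_def)
    with det have tr: "trace (S ** N) \<noteq> 0" by (auto simp: zero_power)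
    define M where "M = cscale (?n / trace (S ** N)) N"
    have c: "?n / trace (S ** N) \<noteq> 0" using tr by simp
    have "M \<in> p" unfolding M_def N(1) line_eq by blast
    moreover have "M \<noteq> 0" using c N(2) by (simp add: M_def)
    ultimately have pM: "p = cmat.span {M}" by (intro line_eqI[OF \<open>p \<in> proj_space\<close>])
    have "M \<in> ?L"
      unfolding L using p pM cone_cscale[OF X NX] det c tr
        hom_poly_fun_D(2)[OF hom_poly_fun_det, of "?n / trace (S ** N)" N]
      by (simp add: M_def trace_mult_linear)
    then show "p \<in> (\<lambda>M. cmat.span {M}) ` ?L" using pM by blast
  qed
qed

theorem corollary1p2:
  fixes X :: "(complex^'n^'n) set set"
  assumes "proj_closed X" and "proj_irreducible X"
  shows "for_generic (\<lambda>S.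
           (finite (det_trace_critical_points X S) \<longleftrightarrow> finite (likelihood_critical_points X S)) \<and>
           card (det_trace_critical_points X S) = card (likelihood_critical_points X S)) \<and>
         (\<forall>d. is_gaussian_ML_degree X d \<longleftrightarrow>
           for_generic (\<lambda>S. finite (det_trace_critical_points X S) \<and>
                            card (det_trace_critical_points X S) = d))"
proof -
  let ?same = "\<lambda>S. (finite (det_trace_critical_points X S) \<longleftrightarrow> finite (likelihood_critical_points X S)) \<and>
           card (det_trace_critical_points X S) = card (likelihood_critical_points X S)"
  have X: "X \<subseteq> proj_space" using assms(1) by (auto simp: proj_closed_def)
  have irr: "irreducible_set (affine_cone X)" by (rule affine_cone_irreducible[OF X assms(2)])
  obtain W where W: "finite W" "W \<subseteq> sym_mats - {0}"
    "\<And>S p a b M. \<forall>N\<in>W. trace (S ** N) \<noteq> 0 \<Longrightarrow> p \<in> X \<Longrightarrow>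
       unit_rep X det (trace_power S) p a b \<Longrightarrow> M \<in> p - {0} \<Longrightarrow> det M \<noteq> 0"
    using det_nonzero_at_units[OF X] by meson
  have "for_generic (\<lambda>S. \<forall>N\<in>W. trace (S ** N) \<noteq> 0)"
    using W by (intro for_generic_ball for_generic_trace_nonzero) auto
  then have same: "for_generic ?same"
  proof (rule for_generic_mono)
    fix S :: "complex^'n^'n" assume "\<forall>N\<in>W. trace (S ** N) \<noteq> 0"
    from critical_points_bij_betw[OF X irr W(3)[OF this]]
    have "bij_betw (\<lambda>M. cmat.span {M}) (likelihood_critical_points X S) (det_trace_critical_points X S)" .
    then show "?same S" using bij_betw_finite bij_betw_same_card by metis
  qed
  moreover have "is_gaussian_ML_degree X d \<longleftrightarrow>
      for_generic (\<lambda>S. finite (det_trace_critical_points X S) \<and> card (det_trace_critical_points X S) = d)" for d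
    unfolding is_gaussian_ML_degree_def
    by (intro iffI; drule for_generic_conj[OF same]; erule for_generic_mono; auto)
  ultimately show ?thesis by blast
qed

end
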